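(* Let $p$ be a prime, let $\alpha\in\mathbb{F}_p^\times$ with $\alpha\neq 1$, and let $X=\mathrm{Aff}(p,\alpha)$ be the corresponding affine rack. Let $K$ be a field of characteristic zero and let $\mathcal{B}(X,q)$ be the Nichols algebra over $K$ associated with $X$ and with the constant cocycle $q\equiv -1$. Then $\Gamma_2(\mathcal{B}(X,q))=\emptyset$.
   Context: The affine rack $\mathrm{Aff}(p,\alpha)$ has underlying set $X=\{x_g : g\in\mathbb{F}_p\}$ and operation $x_g\triangleright x_h=x_{(1-\alpha)g+\alpha h}$. Nichols algebras. A $2$-cocycle of a finite rack $(X,\triangleright)$ over $K$ is a map $q\colon X\times X\to K^\times$, $(x,y)\mapsto q_{x,y}$, with $q_{x,y\triangleright z}\,q_{y,z}=q_{x\triangleright y,x\triangleright z}\,q_{x,z}$ for all $x,y,z\in X$ (constant maps are $2$-cocycles). Let $V=KX$ be the vector space with basis $X$ and let $c\in \mathrm{GL}(V\otimes V)$, $c(x\otimes y)=q_{x,y}\,(x\triangleright y)\otimes x$. On $V^{\otimes n}$ let $c_i$ act as $c$ on the tensor factors $i,i+1$ and as the identity elsewhere. Define $\mathcal{S}_1=I$ and $\mathcal{S}_{n+1}=(I\otimes\mathcal{S}_n)(I+c_1+c_1c_2+\cdots+c_1c_2\cdots c_n)$; in particular $\mathcal{S}_2=I+c_1$. The Nichols algebra is the graded algebra $\mathcal{B}(X,q)=K\oplus V\oplus\bigoplus_{n\ge 2}V^{\otimes n}/\ker\mathcal{S}_n$, a quotient of the tensor algebra $T(V)$. Truncated point modules.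 For a connected graded $K$-algebra $A$ generated in degree one by finitely many elements, an $n$-truncated point module is a graded (left) $A$-module generated in degree $0$ with Hilbert series $1+t+\cdots+t^n$. $\Gamma_n(A)$ denotes the set of $n$-truncated point modules over $A$ up to graded isomorphism. *)

theory Defs
  imports
    "HOL-Algebra.QuotRing"
    "HOL-Algebra.Module"
    "HOL-Number_Theory.Residues"
    "HOL-Computational_Algebra.Formal_Power_Series"
begin

section \<open>Affine racks\<close>

text \<open>The element $x_g$ of $\mathrm{Aff}(p,\alpha)$ is represented by $g$ itself, an element of
  the library's model of $\mathbb{F}_p$ on the integers $0,\dots,p-1$.\<close>

definition aff_rack :: "nat \<Rightarrow> int set" where
  "aff_rack p = carrier (residue_ring (int p))"

definition aff_op :: "nat \<Rightarrow> int \<Rightarrow> int \<Rightarrow> int \<Rightarrow> int" where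
  "aff_op p \<alpha> g h =
    (let F = residue_ring (int p)
     in (\<one>\<^bsub>F\<^esub> \<ominus>\<^bsub>F\<^esub> \<alpha>) \<otimes>\<^bsub>F\<^esub> g \<oplus>\<^bsub>F\<^esub> \<alpha> \<otimes>\<^bsub>F\<^esub> h)"


section \<open>The tensor algebra\<close>

text \<open>With $V = KX$, the space $V^{\otimes n}$ has as basis the words of length $n$ over $X$. An
  element of $T(V)$ is the function giving its coefficients in the basis of all words. The
  \<open>module\<close> record also has the ring operations, so it describes a $K$-algebra; the locale of
  the same name is not used, because it requires a commutative base ring.\<close>

definition word :: "'x list \<Rightarrow> 'x list \<Rightarrow> 'k::field" where
  "word w = (\<lambda>v. if v = w then 1 else 0)"

definition tensor_algebra :: "'x set \<Rightarrow> ('k::field, 'x list \<Rightarrow> 'k) module" where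
  "tensor_algebra X =
    \<lparr>carrier = {f. finite {w. f w \<noteq> 0} \<and> {w. f w \<noteq> 0} \<subseteq> lists X},
     monoid.mult = (\<lambda>f g w. \<Sum>i\<le>length w. f (take i w) * g (drop i w)),
     one = word [],
     zero = (\<lambda>_. 0),
     add = (\<lambda>f g w. f w + g w),
     smult = (\<lambda>c f w. c * f w)\<rparr>"

definition hom_part :: "nat \<Rightarrow> ('x list \<Rightarrow> 'k::field) \<Rightarrow> 'x list \<Rightarrow> 'k" where
  "hom_part n f = (\<lambda>w. if length w = n then f w else 0)"

definition tensor_power :: "'x set \<Rightarrow> nat \<Rightarrow> ('x list \<Rightarrow> 'k::field) set" where
  "tensor_power X n = {f \<in> carrier (tensor_algebra X). hom_part n f = f}"

definition lin_ext :: "('x list \<Rightarrow> 'x list \<Rightarrow> 'k::field) \<Rightarrow> ('x list \<Rightarrow> 'k) \<Rightarrow> 'x list \<Rightarrow> 'k" where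
  "lin_ext \<phi> f = (\<lambda>v. \<Sum>w | f w \<noteq> 0. f w * \<phi> w v)"


section \<open>Nichols algebras\<close>

text \<open>Tensor factors are counted from 0, so \<open>braid_at op q i\<close> is $c_{i+1}$: it acts on the basis
  by $x \otimes y \mapsto q_{x,y}\,(x \triangleright y) \otimes x$ in the positions $i$ and $i+1$.\<close>

definition braid_at ::
  "('x \<Rightarrow> 'x \<Rightarrow> 'x) \<Rightarrow> ('x \<Rightarrow> 'x \<Rightarrow> 'k::field) \<Rightarrow> nat \<Rightarrow> ('x list \<Rightarrow> 'k) \<Rightarrow> 'x list \<Rightarrow> 'k" where
  "braid_at op q i =
    lin_ext (\<lambda>w v. q (w ! i) (w ! Suc i) *
                   word (w[i := op (w ! i) (w ! Suc i), Suc i := w ! i]) v)"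

text \<open>\<open>braid_prod op q j\<close> is the operator product $c_1 c_2 \cdots c_j$, in which $c_j$ is
  applied first.\<close>

primrec braid_prod ::
  "('x \<Rightarrow> 'x \<Rightarrow> 'x) \<Rightarrow> ('x \<Rightarrow> 'x \<Rightarrow> 'k::field) \<Rightarrow> nat \<Rightarrow> ('x list \<Rightarrow> 'k) \<Rightarrow> 'x list \<Rightarrow> 'k" where
  "braid_prod op q 0 = id"
| "braid_prod op q (Suc j) = braid_prod op q j \<circ> braid_at op q j"

text \<open>$I \otimes P$ on $V \otimes V^{\otimes n}$: every element is $\sum_y y \otimes f_y$ with
  $f_y(u) = f(y u)$, and it is sent to $\sum_y y \otimes P f_y$.\<close>

definition id_tensor ::
  "(('x list \<Rightarrow> 'k::field) \<Rightarrow> 'x list \<Rightarrow> 'k) \<Rightarrow> ('x list \<Rightarrow> 'k) \<Rightarrow> 'x list \<Rightarrow> 'k" where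
  "id_tensor P f = (\<lambda>w. case w of [] \<Rightarrow> 0 | y # u \<Rightarrow> P (\<lambda>u'. f (y # u')) u)"

text \<open>\<open>quantum_sym op q n\<close> is $\mathcal{S}_n$; only its values on $V^{\otimes n}$ are meaningful.\<close>

fun quantum_sym ::
  "('x \<Rightarrow> 'x \<Rightarrow> 'x) \<Rightarrow> ('x \<Rightarrow> 'x \<Rightarrow> 'k::field) \<Rightarrow> nat \<Rightarrow> ('x list \<Rightarrow> 'k) \<Rightarrow> 'x list \<Rightarrow> 'k" where
  "quantum_sym op q 0 = id"
| "quantum_sym op q (Suc 0) = id"
| "quantum_sym op q (Suc (Suc n)) =
     id_tensor (quantum_sym op q (Suc n)) \<circ> (\<lambda>f w. \<Sum>j\<le>Suc n. braid_prod op q j f w)"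

text \<open>$\bigoplus_n \ker \mathcal{S}_n$; the summands for $n = 0, 1$ vanish.\<close>

definition nichols_ideal ::
  "'x set \<Rightarrow> ('x \<Rightarrow> 'x \<Rightarrow> 'x) \<Rightarrow> ('x \<Rightarrow> 'x \<Rightarrow> 'k::field) \<Rightarrow> ('x list \<Rightarrow> 'k) set" where
  "nichols_ideal X op q =
    {f \<in> carrier (tensor_algebra X). \<forall>n. quantum_sym op q n (hom_part n f) = (\<lambda>_. 0)}"

text \<open>One record type serves for graded algebras over \<open>'s\<close> and for graded modules over an algebra
  with elements in \<open>'s\<close>. For modules the fields \<open>mult\<close> and \<open>one\<close> are ignored, as in the library's
  \<open>module\<close> record.\<close>

record ('s, 'a) graded = "('s, 'a) module" +
  grade :: "nat \<Rightarrow> 'a set"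

definition nichols_algebra ::
  "'x set \<Rightarrow> ('x \<Rightarrow> 'x \<Rightarrow> 'x) \<Rightarrow> ('x \<Rightarrow> 'x \<Rightarrow> 'k::field) \<Rightarrow> ('k, ('x list \<Rightarrow> 'k) set) graded" where
  "nichols_algebra X op q =
    (let T = tensor_algebra X; I = nichols_ideal X op q; Q = T Quot I in
     \<lparr>carrier = carrier Q,
      monoid.mult = monoid.mult Q,
      one = one Q,
      zero = zero Q,
      add = add Q,
      smult = (\<lambda>c A. \<Union>a\<in>A. I +>\<^bsub>T\<^esub> (c \<odot>\<^bsub>T\<^esub> a)),
      grade = (\<lambda>n. (\<lambda>f. I +>\<^bsub>T\<^esub> f) ` tensor_power X n)\<rparr>)"


section \<open>Graded modules and truncated point modules\<close>

text \<open>The axioms of the library's locale \<open>module\<close>, over a ring that need not be commutative.\<close>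

locale left_module = R?: ring R + M?: abelian_group M
  for R :: "('a, 'r) ring_scheme" (structure) and M :: "('a, 'm, 'z) module_scheme" (structure) +
  assumes smult_closed:
      "\<lbrakk>a \<in> carrier R; x \<in> carrier M\<rbrakk> \<Longrightarrow> a \<odot>\<^bsub>M\<^esub> x \<in> carrier M"
    and smult_l_distr:
      "\<lbrakk>a \<in> carrier R; b \<in> carrier R; x \<in> carrier M\<rbrakk> \<Longrightarrow>
        (a \<oplus>\<^bsub>R\<^esub> b) \<odot>\<^bsub>M\<^esub> x = a \<odot>\<^bsub>M\<^esub> x \<oplus>\<^bsub>M\<^esub> b \<odot>\<^bsub>M\<^esub> x"
    and smult_r_distr:
      "\<lbrakk>a \<in> carrier R; x \<in> carrier M; y \<in> carrier M\<rbrakk> \<Longrightarrow>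
        a \<odot>\<^bsub>M\<^esub> (x \<oplus>\<^bsub>M\<^esub> y) = a \<odot>\<^bsub>M\<^esub> x \<oplus>\<^bsub>M\<^esub> a \<odot>\<^bsub>M\<^esub> y"
    and smult_assoc:
      "\<lbrakk>a \<in> carrier R; b \<in> carrier R; x \<in> carrier M\<rbrakk> \<Longrightarrow>
        (a \<otimes>\<^bsub>R\<^esub> b) \<odot>\<^bsub>M\<^esub> x = a \<odot>\<^bsub>M\<^esub> (b \<odot>\<^bsub>M\<^esub> x)"
    and smult_one:
      "x \<in> carrier M \<Longrightarrow> \<one>\<^bsub>R\<^esub> \<odot>\<^bsub>M\<^esub> x = x"

text \<open>The carrier is the internal direct sum of the homogeneous components, and
  $A_i M_j \subseteq M_{i+j}$. A module generated in degree 0 has no components of negative degree,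
  so gradings by the natural numbers suffice.\<close>

locale graded_left_module = left_module A M
  for A :: "('k, 'a) graded" (structure) and M :: "('a, 'm) graded" (structure) +
  assumes grade_subgroup: "additive_subgroup (grade M i) M"
    and grade_decomp:
      "x \<in> carrier M \<Longrightarrow>
        \<exists>!f. (\<forall>i. f i \<in> grade M i) \<and> finite {i. f i \<noteq> \<zero>\<^bsub>M\<^esub>} \<and>
             x = finsum M f {i. f i \<noteq> \<zero>\<^bsub>M\<^esub>}"
    and grade_smult:
      "\<lbrakk>a \<in> grade A i; x \<in> grade M j\<rbrakk> \<Longrightarrow> a \<odot>\<^bsub>M\<^esub> x \<in> grade M (i + j)"

text \<open>A module over the $K$-algebra $A$ is a $K$-vector space through $c \cdot x = (c 1_A) x$.\<close>

definition scalar_mult ::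
  "('k, 'a) graded \<Rightarrow> ('a, 'm) graded \<Rightarrow> 'k \<Rightarrow> 'm \<Rightarrow> 'm" where
  "scalar_mult A M c x = (c \<odot>\<^bsub>A\<^esub> \<one>\<^bsub>A\<^esub>) \<odot>\<^bsub>M\<^esub> x"

text \<open>\<open>W\<close> has a \<open>K\<close>-basis consisting of \<open>d\<close> vectors.\<close>

definition has_dimension ::
  "('k, 'a) graded \<Rightarrow> ('a, 'm) graded \<Rightarrow> 'm set \<Rightarrow> nat \<Rightarrow> bool" where
  "has_dimension A M W d \<longleftrightarrow>
    (\<exists>b :: nat \<Rightarrow> 'm. b ` {..<d} \<subseteq> W \<and>
      (\<forall>x\<in>W. \<exists>!c. c \<in> {..<d} \<rightarrow>\<^sub>E UNIV \<and>
        x = finsum M (\<lambda>i. scalar_mult A M (c i) (b i)) {..<d}))"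

definition has_hilbert_series :: "('k, 'a) graded \<Rightarrow> ('a, 'm) graded \<Rightarrow> nat fps \<Rightarrow> bool" where
  "has_hilbert_series A M h \<longleftrightarrow> (\<forall>i. has_dimension A M (grade M i) (fps_nth h i))"

definition generated_in_degree_0 :: "('k, 'a) graded \<Rightarrow> ('a, 'm) graded \<Rightarrow> bool" where
  "generated_in_degree_0 A M \<longleftrightarrow>
    (\<forall>N. submodule N A M \<longrightarrow> grade M 0 \<subseteq> N \<longrightarrow> N = carrier M)"

definition truncated_point_module :: "nat \<Rightarrow> ('k, 'a) graded \<Rightarrow> ('a, 'm) graded \<Rightarrow> bool" where
  "truncated_point_module n A M \<longleftrightarrow>
    graded_left_module A M \<and> generated_in_degree_0 A M \<and>
    has_hilbert_series A M (\<Sum>i\<le>n. fps_X ^ i)"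

definition graded_isomorphic ::
  "('k, 'a) graded \<Rightarrow> ('a, 'm) graded \<Rightarrow> ('a, 'm) graded \<Rightarrow> bool" where
  "graded_isomorphic A M N \<longleftrightarrow>
    (\<exists>\<phi> \<in> iso (add_monoid M) (add_monoid N).
      (\<forall>a\<in>carrier A. \<forall>x\<in>carrier M. \<phi> (a \<odot>\<^bsub>M\<^esub> x) = a \<odot>\<^bsub>N\<^esub> \<phi> x) \<and>
      (\<forall>i. \<phi> ` grade M i = grade N i))"

text \<open>$\Gamma_n(A)$, as the set of isomorphism classes of the modules whose elements belong to the
  type \<open>'m\<close>.\<close>

definition Gamma :: "nat \<Rightarrow> ('k, 'a) graded \<Rightarrow> ('a, 'm) graded set set" where
  "Gamma n A =
    {M. truncated_point_module n A M} //
    {(M, N). truncated_point_module n A M \<and> truncated_point_module n A N \<and>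
             graded_isomorphic A M N}"

end

theory Submission
  imports Defs "HOL-Computational_Algebra.Polynomial"
begin

text \<open>Let $M$ be a 2-truncated point module with basis $m_0, m_1, m_2$, and write
  $x_g m_0 = a_g m_1$ and $x_g m_1 = b_g m_2$. The braiding maps $x_g \otimes x_h$ to
  $-x_{g'} \otimes x_g$ with $g' + \alpha g = g + \alpha h$, so that $x_g^2$ and
  $\sum_h x_{t - \alpha h} x_h$, for each $t \in \mathbb{F}_p$, are killed by $\mathcal{S}_2$. Hence
  $a_g b_g = 0$ for all $g$ and $\sum_h a_h b_{t - \alpha h} = 0$ for all $t$, whereas $a \neq 0$ and
  $b \neq 0$ because $M$ is generated in degree 0.

  Such $a$ and $b$ do not exist. Choose a valuation ring $R$ of $K$ whose maximal ideal $I$ contains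
  $p$, and scale $a$ and $b$ to have entries in $R$ and some entry equal to 1. Let $i$ and $j$ be
  minimal such that the moments $\sum_h h^i a_h$ and $\sum_g g^j b_g$ are not in $I$. A Vandermonde
  argument modulo $I$ shows that $i$ and $j$ are smaller than the sizes of the supports of $a$ and
  $b$; these supports are disjoint, so $i + j < p$. Modulo $I$, the sum
  $\sum_{g,h} (\alpha h + g)^{i+j} a_h b_g$ vanishes by the convolution equations, but by the binomial
  theorem it is $\binom{i+j}{i} \alpha^i$ times the product of the two moments.\<close>

section \<open>Valuation rings above a prime\<close>

definition nonunital_subring :: "'a::comm_ring set \<Rightarrow> bool" where
  "nonunital_subring I \<longleftrightarrow> 0 \<in> I \<and> (\<forall>x\<in>I. \<forall>y\<in>I. x - y \<in> I) \<and> (\<forall>x\<in>I. \<forall>y\<in>I. x * y \<in> I)"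

lemma nonunital_subringD:
  assumes "nonunital_subring I"
  shows nonunital_subring_0: "0 \<in> I"
    and nonunital_subring_diff: "x \<in> I \<Longrightarrow> y \<in> I \<Longrightarrow> x - y \<in> I"
    and nonunital_subring_mult: "x \<in> I \<Longrightarrow> y \<in> I \<Longrightarrow> x * y \<in> I"
  using assms by (auto simp: nonunital_subring_def)

lemma nonunital_subring_uminus: "nonunital_subring I \<Longrightarrow> x \<in> I \<Longrightarrow> - x \<in> I"
  by (metis diff_0 nonunital_subringD(1,2))

lemma nonunital_subring_add: "nonunital_subring I \<Longrightarrow> x \<in> I \<Longrightarrow> y \<in> I \<Longrightarrow> x + y \<in> I"
  by (metis diff_minus_eq_add nonunital_subring_uminus nonunital_subring_diff)

lemma nonunital_subring_sum:
  "nonunital_subring I \<Longrightarrow> (\<And>s. s \<in> S \<Longrightarrow> f s \<in> I) \<Longrightarrow> sum f S \<in> I"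
  by (induction S rule: infinite_finite_induct)
    (auto intro: nonunital_subring_0 nonunital_subring_add)

text \<open>The constant term is taken from \<open>I\<close> as well, so that
  \<open>1 \<in> adjoin I x\<close> is a genuine condition: it says that 1 is a polynomial in
  \<open>x\<close> with coefficients in \<open>I\<close>.\<close>

definition adjoin :: "'a::comm_ring_1 set \<Rightarrow> 'a \<Rightarrow> 'a set" where
  "adjoin I x = {poly P x | P. \<forall>i. poly.coeff P i \<in> I}"

lemma nonunital_subring_adjoin:
  assumes I: "nonunital_subring I"
  shows "nonunital_subring (adjoin I x)"
  unfolding nonunital_subring_def
proof (intro conjI ballI)
  show "0 \<in> adjoin I x"
    unfolding adjoin_def by (auto intro!: exI[of _ 0] simp: nonunital_subring_0[OF I])
next
  fix u v assume "u \<in> adjoin I x" "v \<in> adjoin I x"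
  then obtain P Q where "u = poly P x" "v = poly Q x"
    "\<forall>i. poly.coeff P i \<in> I" "\<forall>i. poly.coeff Q i \<in> I"
    unfolding adjoin_def by blast
  then have "u - v = poly (P - Q) x" "u * v = poly (P * Q) x"
    "\<forall>i. poly.coeff (P - Q) i \<in> I" "\<forall>i. poly.coeff (P * Q) i \<in> I"
    by (simp_all add: coeff_mult nonunital_subring_diff[OF I] nonunital_subring_mult[OF I]
        nonunital_subring_sum[OF I])
  then show "u - v \<in> adjoin I x" "u * v \<in> adjoin I x"
    unfolding adjoin_def mem_Collect_eq by metis+
qed

lemma subset_adjoin:
  assumes "nonunital_subring I"
  shows "I \<subseteq> adjoin I x"
proof
  fix y assume "y \<in> I"
  then show "y \<in> adjoin I x"
    unfolding adjoin_def
    by (auto intro!: exI[of _ "[:y:]"] simp: coeff_pCons nonunital_subring_0[OF assms] split: nat.splits)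
qed

lemma mult_mem_adjoin:
  assumes "nonunital_subring I" "y \<in> I"
  shows "x * y \<in> adjoin I x"
  unfolding adjoin_def
  by (auto intro!: exI[of _ "[:0, y:]"]
      simp: coeff_pCons assms nonunital_subring_0[OF assms(1)] split: nat.splits)

text \<open>The explicit degree bound serves as the measure for a descent: the aim is that
  \<open>x\<close> and \<open>inverse x\<close> cannot both satisfy such a relation when
  \<open>1 \<notin> I\<close>.\<close>

definition one_combination :: "'a::field set \<Rightarrow> 'a \<Rightarrow> nat \<Rightarrow> bool" where
  "one_combination I x n \<longleftrightarrow> (\<exists>c. (\<forall>k. c k \<in> I) \<and> (\<Sum>k\<le>n. c k * x ^ k) = 1)"

lemma one_combination_mono:
  assumes I: "nonunital_subring I" and "one_combination I x m" "m \<le> n"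
  shows "one_combination I x n"
proof -
  obtain c where c: "\<forall>k. c k \<in> I" "(\<Sum>k\<le>m. c k * x ^ k) = 1"
    using assms by (auto simp: one_combination_def)
  have "(\<Sum>k\<le>n. (if k \<le> m then c k else 0) * x ^ k) = (\<Sum>k\<le>m. c k * x ^ k)"
    by (rule sum.mono_neutral_cong_right) (use \<open>m \<le> n\<close> in auto)
  then show ?thesis
    using c nonunital_subring_0[OF I]
    by (auto simp: one_combination_def intro!: exI[of _ "\<lambda>k. if k \<le> m then c k else 0"])
qed

text \<open>The leading term of the relation for \<open>x\<close>, multiplied by \<open>1 - d 0\<close>, is rewritten by means of the
  relation for \<open>inverse x\<close>; this avoids dividing by the element \<open>1 - d 0\<close>.\<close>

lemma one_combination_descent:
  assumes I: "nonunital_subring I" and "x \<noteq> 0"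
    and "one_combination I x (Suc n)" "one_combination I (inverse x) (Suc n)"
  shows "one_combination I x n"
proof -
  obtain c where c: "\<And>k. c k \<in> I" "(\<Sum>k\<le>Suc n. c k * x ^ k) = 1"
    using assms by (auto simp: one_combination_def)
  obtain d where d: "\<And>k. d k \<in> I" "(\<Sum>k\<le>Suc n. d k * inverse x ^ k) = 1"
    using assms by (auto simp: one_combination_def)
  \<comment> \<open>The rewritten relation has value \<open>1 - d 0\<close> instead of 1; adding
    \<open>d 0\<close> to its constant coefficient restores the value 1.\<close>
  define e where
    "e k = (1 - d 0) * c k + c (Suc n) * d (Suc n - k) + (if k = 0 then d 0 else 0)" for k
  have "x ^ Suc n = x ^ Suc n * (\<Sum>k\<le>Suc n. d k * inverse x ^ k)"
    by (simp only: d mult_1_right)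
  also have "\<dots> = (\<Sum>k\<le>Suc n. d k * x ^ (Suc n - k))"
    unfolding sum_distrib_left
  proof (rule sum.cong)
    fix k assume "k \<in> {..Suc n}"
    then have "x ^ Suc n = x ^ (Suc n - k) * x ^ k"
      by (simp flip: power_add)
    then show "x ^ Suc n * (d k * inverse x ^ k) = d k * x ^ (Suc n - k)"
      using \<open>x \<noteq> 0\<close> by (simp add: field_simps)
  qed simp
  also have "\<dots> = (\<Sum>k\<le>Suc n. d (Suc n - k) * x ^ k)"
    by (rule sum.reindex_bij_witness[of _ "\<lambda>k. Suc n - k" "\<lambda>k. Suc n - k"]) auto
  also have "\<dots> = (\<Sum>k\<le>n. d (Suc n - k) * x ^ k) + d 0 * x ^ Suc n"
    by simp
  finally have top: "(\<Sum>k\<le>n. d (Suc n - k) * x ^ k) = (1 - d 0) * x ^ Suc n"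
    unfolding left_diff_distrib mult_1_left eq_diff_eq by (rule sym)
  have "(\<Sum>k\<le>n. e k * x ^ k) = (1 - d 0) * (\<Sum>k\<le>n. c k * x ^ k)
      + c (Suc n) * (\<Sum>k\<le>n. d (Suc n - k) * x ^ k) + (\<Sum>k\<le>n. if k = 0 then d 0 else 0)"
    unfolding sum_distrib_left sum.distrib[symmetric]
    by (intro sum.cong refl) (auto simp: e_def algebra_simps)
  also have "\<dots> = (1 - d 0) * (\<Sum>k\<le>Suc n. c k * x ^ k) + d 0"
    by (simp only: top sum.atMost_Suc distrib_left) (simp add: mult_ac)
  also have "\<dots> = 1"
    by (simp only: c) simp
  finally have "(\<Sum>k\<le>n. e k * x ^ k) = 1" .
  moreover have "e k \<in> I" for k
  proof -
    \<comment> \<open>The factor \<open>1 - d 0\<close> need not lie in \<open>I\<close>, but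
      \<open>(1 - d 0) * c k\<close> does once it is expanded.\<close>
    have "c k - d 0 * c k + c (Suc n) * d (Suc n - k) + (if k = 0 then d 0 else 0) \<in> I"
      by (intro nonunital_subring_add[OF I] nonunital_subringD[OF I])
        (auto intro: c d nonunital_subring_0[OF I])
    then show ?thesis by (simp add: e_def algebra_simps)
  qed
  ultimately show ?thesis by (auto simp: one_combination_def)
qed

text \<open>Raise the shorter of the two relations to the degree of the longer one and lower the
  longer one by descent. The sum of the degrees drops until both are 0, and then a relation says
  that 1 itself lies in \<open>I\<close>.\<close>

lemma one_combination_inverse_contradiction:
  assumes I: "nonunital_subring I" "1 \<notin> I"
  shows "x \<noteq> 0 \<Longrightarrow> one_combination I x m \<Longrightarrow> one_combination I (inverse x) n \<Longrightarrow> False"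
proof (induction "m + n" arbitrary: m n x rule: less_induct)
  case less
  consider "m = 0" "n = 0" | k where "m = Suc k" "n \<le> m" | k where "n = Suc k" "m \<le> n"
    by (cases m; cases n) (auto, metis linear)
  then show False
  proof cases
    case 1
    then obtain c where "\<forall>k. c k \<in> I" "c 0 = 1"
      using less.prems(2) unfolding one_combination_def by fastforce
    then show False using I(2) by metis
  next
    case (2 k)
    then have "one_combination I x k"
      using less.prems one_combination_descent[OF I(1)] one_combination_mono[OF I(1)] by metis
    then show False using less.hyps[of k n x] 2 less.prems by simp
  next
    case (3 k)
    then have "one_combination I (inverse x) k"
      using less.prems one_combination_descent[OF I(1), of "inverse x" k]
        one_combination_mono[OF I(1)] by (metis inverse_inverse_eq nonzero_imp_inverse_nonzero)
    then show False using less.hyps[of m k x] 3 less.prems by simp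
  qed
qed

lemma one_mem_adjoinD:
  assumes "1 \<in> adjoin I x"
  shows "\<exists>n. one_combination I x n"
proof -
  obtain P where "\<forall>i. poly.coeff P i \<in> I" "poly P x = 1"
    using assms by (auto simp: adjoin_def)
  then show ?thesis
    unfolding one_combination_def by (metis poly_altdef)
qed

text \<open>This stands in for an extension of the p-adic valuation to the field: \<open>R\<close>
  is the valuation ring and \<open>I\<close> a prime ideal above \<open>p\<close>. Congruences
  modulo \<open>I\<close> are expressed as membership of differences, so that no residue field has
  to be constructed.\<close>

locale place =
  fixes R I :: "'k::field set" and p :: nat
  assumes one_R: "1 \<in> R"
    and diff_R: "x \<in> R \<Longrightarrow> y \<in> R \<Longrightarrow> x - y \<in> R"
    and mult_R: "x \<in> R \<Longrightarrow> y \<in> R \<Longrightarrow> x * y \<in> R"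
    and diff_I: "x \<in> I \<Longrightarrow> y \<in> I \<Longrightarrow> x - y \<in> I"
    and ideal_I: "x \<in> R \<Longrightarrow> y \<in> I \<Longrightarrow> x * y \<in> I"
    and prime_I: "x \<in> R \<Longrightarrow> y \<in> R \<Longrightarrow> x * y \<in> I \<Longrightarrow> x \<in> I \<or> y \<in> I"
    and p_I: "of_nat p \<in> I"
    and one_I: "1 \<notin> I"
    and valuation: "x \<notin> R \<Longrightarrow> inverse x \<in> R"

text \<open>\<open>I\<close> is chosen maximal among the subrings without unit that contain \<open>p\<close> but not 1, and \<open>R\<close> is its
  idealizer.\<close>

theorem place_exists:
  assumes "prime p"
  shows "\<exists>R I :: 'k::field_char_0 set. place R I p"
proof -
  define \<A> where "\<A> = {I :: 'k set. nonunital_subring I \<and> of_nat p \<in> I \<and> 1 \<notin> I}"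
  \<comment> \<open>The starting point for Zorn's lemma is the image of pZ. Characteristic zero
    makes Z embed into the field, so 1 is not in this image.\<close>
  have "range (\<lambda>n. of_int (int p * n)) \<in> \<A>"
  proof -
    have "nonunital_subring (range (\<lambda>n. of_int (int p * n) :: 'k))"
      unfolding nonunital_subring_def
    proof (intro conjI ballI)
      fix x y :: 'k assume "x \<in> range (\<lambda>n. of_int (int p * n))" "y \<in> range (\<lambda>n. of_int (int p * n))"
      then obtain m n where "x = of_int (int p * m)" "y = of_int (int p * n)" by blast
      then have "x - y = of_int (int p * (m - n))" "x * y = of_int (int p * (m * int p * n))"
        by (simp_all add: right_diff_distrib)
      then show "x - y \<in> range (\<lambda>n. of_int (int p * n))" "x * y \<in> range (\<lambda>n. of_int (int p * n))"
        by (metis rangeI)+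
    qed auto
    moreover have "(1 :: 'k) \<noteq> of_int (int p * n)" for n
    proof
      assume "(1 :: 'k) = of_int (int p * n)"
      then have "1 = int p * n" by (metis of_int_1 of_int_eq_iff)
      then show False
        using assms by (metis dvd_triv_left int_dvd_int_iff not_prime_unit of_nat_1)
    qed
    moreover have "(of_nat p :: 'k) \<in> range (\<lambda>n. of_int (int p * n))"
      by (auto intro!: image_eqI[of _ _ 1])
    ultimately show ?thesis unfolding \<A>_def by blast
  qed
  then have "\<A> \<noteq> {}" by blast
  moreover have "\<Union>\<C> \<in> \<A>" if \<C>: "\<C> \<noteq> {}" "subset.chain \<A> \<C>" for \<C>
  proof -
    have sub: "\<And>I. I \<in> \<C> \<Longrightarrow> nonunital_subring I \<and> of_nat p \<in> I \<and> 1 \<notin> I"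
      using \<C> by (auto simp: subset.chain_def \<A>_def)
    have "nonunital_subring (\<Union>\<C>)"
      unfolding nonunital_subring_def
    proof (intro conjI ballI)
      show "0 \<in> \<Union>\<C>" using \<C>(1) sub nonunital_subring_0 by blast
    next
      fix x y assume "x \<in> \<Union>\<C>" "y \<in> \<Union>\<C>"
      then obtain I where "I \<in> \<C>" "x \<in> I" "y \<in> I"
        using \<C>(2) unfolding subset_chain_def by blast
      then show "x - y \<in> \<Union>\<C>" "x * y \<in> \<Union>\<C>"
        using sub nonunital_subringD by blast+
    qed
    then show ?thesis using sub \<C>(1) unfolding \<A>_def by blast
  qed
  ultimately have "\<exists>I\<in>\<A>. \<forall>J\<in>\<A>. I \<subseteq> J \<longrightarrow> J = I"
    by (rule subset_Zorn_nonempty)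
  then obtain I where "I \<in> \<A>" and max: "\<And>J. J \<in> \<A> \<Longrightarrow> I \<subseteq> J \<Longrightarrow> J = I"
    by auto
  then have I: "nonunital_subring I" "of_nat p \<in> I" "1 \<notin> I"
    by (auto simp: \<A>_def)
  define R where "R = {x. \<forall>y\<in>I. x * y \<in> I}"
  have IR: "I \<subseteq> R"
    using nonunital_subring_mult[OF I(1)] by (auto simp: R_def)
  have one: "1 \<in> R" by (simp add: R_def)
  have diff: "x - y \<in> R" if "x \<in> R" "y \<in> R" for x y
    using that nonunital_subring_diff[OF I(1)] by (auto simp: R_def left_diff_distrib)
  have mult: "x * y \<in> R" if "x \<in> R" "y \<in> R" for x y
    using that by (auto simp: R_def mult.assoc)
  have ideal: "x * y \<in> I" if "x \<in> R" "y \<in> I" for x y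
    using that by (auto simp: R_def)
  \<comment> \<open>If 1 is not in \<open>adjoin I x\<close>, then maximality gives
    \<open>adjoin I x = I\<close>. As \<open>adjoin I x\<close> contains \<open>x * y\<close> for
    every \<open>y \<in> I\<close>, this puts \<open>x\<close> in the idealizer.\<close>
  have adj: "x \<in> R \<or> (\<exists>n. one_combination I x n)" for x
  proof (rule disjCI)
    assume "\<not> (\<exists>n. one_combination I x n)"
    then have "1 \<notin> adjoin I x" using one_mem_adjoinD by blast
    then have "adjoin I x = I"
      using nonunital_subring_adjoin[OF I(1)] I(2)
      by (intro max) (simp_all add: \<A>_def subset_adjoin[OF I(1)] subsetD[OF subset_adjoin[OF I(1)]])
    then show "x \<in> R"
      using mult_mem_adjoin[OF I(1)] by (auto simp: R_def)
  qed
  have val: "inverse x \<in> R" if "x \<notin> R" for x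
  proof -
    have "x \<noteq> 0" using that nonunital_subring_0[OF I(1)] IR by auto
    then show ?thesis
      using adj[of x] adj[of "inverse x"] one_combination_inverse_contradiction[OF I(1,3)] that
      by blast
  qed
  \<comment> \<open>\<open>I + x R\<close> is again a subring without unit and strictly larger than
    \<open>I\<close>, so by maximality it contains 1. Thus \<open>x\<close> is invertible modulo
    \<open>I\<close>, from which primality of \<open>I\<close> follows.\<close>
  have unit: "\<exists>i\<in>I. \<exists>r\<in>R. 1 = i + x * r" if x: "x \<in> R" "x \<notin> I" for x
  proof -
    define J where "J = {i + x * r | i r. i \<in> I \<and> r \<in> R}"
    have JI: "u \<in> J" if "u = i + x * r" "i \<in> I" "r \<in> R" for u i r
      using that by (auto simp: J_def)
    have "nonunital_subring J"
      unfolding nonunital_subring_def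
    proof (intro conjI ballI)
      show "0 \<in> J"
        by (rule JI[of _ 0 0]) (use nonunital_subring_0[OF I(1)] IR in auto)
    next
      fix u v assume "u \<in> J" "v \<in> J"
      then obtain i r j s where uv: "u = i + x * r" "v = j + x * s" "i \<in> I" "j \<in> I" "r \<in> R" "s \<in> R"
        by (auto simp: J_def)
      show "u - v \<in> J"
        by (rule JI[of _ "i - j" "r - s"])
          (use uv diff nonunital_subring_diff[OF I(1)] in \<open>auto simp: algebra_simps\<close>)
      have "i * j + (x * s) * i + (x * r) * j \<in> I"
        using uv x(1) by (intro nonunital_subring_add[OF I(1)] ideal mult) (auto simp: IR[THEN subsetD])
      then show "u * v \<in> J"
        by (rule JI[of _ "i * j + (x * s) * i + (x * r) * j" "x * r * s", rotated])
          (use uv x(1) mult in \<open>auto simp: algebra_simps\<close>)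
    qed
    moreover have "I \<subseteq> J"
      using nonunital_subring_0[OF I(1)] IR by (auto intro!: JI[of _ _ 0])
    moreover have "J \<noteq> I"
      using x one nonunital_subring_0[OF I(1)] JI[of x 0 1] by auto
    ultimately have "1 \<in> J"
      using max[of J] I(2) unfolding \<A>_def by blast
    then show ?thesis unfolding J_def by blast
  qed
  have "place R I p"
  proof
    fix x y assume xy: "x \<in> R" "y \<in> R" "x * y \<in> I"
    show "x \<in> I \<or> y \<in> I"
    proof (rule disjCI)
      assume "y \<notin> I"
      then obtain i r where ir: "i \<in> I" "r \<in> R" "1 = i + y * r" using unit xy(2) by metis
      have "x = x * (i + y * r)" using ir(3) by simp
      also have "\<dots> = x * i + r * (x * y)" by (simp add: algebra_simps)
      also have "\<dots> \<in> I"
        by (rule nonunital_subring_add[OF I(1) ideal[OF xy(1) ir(1)] ideal[OF ir(2) xy(3)]])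
      finally show "x \<in> I" .
    qed
  qed (use one diff mult ideal val I nonunital_subring_diff[OF I(1)] in auto)
  then show ?thesis by blast
qed

section \<open>Convolution over a prime field\<close>

context place
begin

lemma zero_R: "0 \<in> R"
  using diff_R[OF one_R one_R] by simp

lemma uminus_R: "x \<in> R \<Longrightarrow> - x \<in> R"
  using diff_R[OF zero_R] by force

lemma add_R: "x \<in> R \<Longrightarrow> y \<in> R \<Longrightarrow> x + y \<in> R"
  using diff_R[OF _ uminus_R] by force

lemma zero_I: "0 \<in> I"
  using diff_I[OF p_I p_I] by simp

lemma add_I: "x \<in> I \<Longrightarrow> y \<in> I \<Longrightarrow> x + y \<in> I"
  using diff_I[OF _ diff_I[OF zero_I]] by force

lemma sum_R: "(\<And>s. s \<in> S \<Longrightarrow> f s \<in> R) \<Longrightarrow> sum f S \<in> R"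
  by (induction S rule: infinite_finite_induct) (auto intro: zero_R add_R)

lemma sum_I: "(\<And>s. s \<in> S \<Longrightarrow> f s \<in> I) \<Longrightarrow> sum f S \<in> I"
  by (induction S rule: infinite_finite_induct) (auto intro: zero_I add_I)

lemma of_nat_R: "of_nat n \<in> R"
  by (induction n) (auto intro: zero_R add_R one_R)

lemma of_int_R: "of_int n \<in> R"
  by (cases n rule: int_cases2) (auto intro: of_nat_R uminus_R)

lemma of_int_mem_I: "int p dvd n \<Longrightarrow> of_int n \<in> I"
  using ideal_I[OF of_int_R p_I] by (auto simp: mult.commute)

text \<open>An integer in \<open>I\<close> that is coprime to \<open>p\<close> would, by Bezout, put
  1 in \<open>I\<close>.\<close>

lemma of_int_mem_I_iff:
  assumes "prime p"
  shows "of_int n \<in> I \<longleftrightarrow> int p dvd n"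
proof
  assume n: "of_int n \<in> I"
  show "int p dvd n"
  proof (rule ccontr)
    assume "\<not> int p dvd n"
    then have "coprime (int p) n"
      using assms by (simp add: prime_imp_coprime)
    then obtain u v where "u * int p + v * n = 1"
      using bezout_int[of "int p" n] by auto
    then have "of_int u * of_int (int p) + of_int v * of_int n = (1 :: 'k)"
      by (metis of_int_1 of_int_add of_int_mult)
    moreover have "of_int u * of_int (int p) + of_int v * of_int n \<in> I"
      by (intro add_I ideal_I of_int_R n of_int_mem_I[OF dvd_refl])
    ultimately show False using one_I by simp
  qed
qed (rule of_int_mem_I)

text \<open>The idea is to divide by an entry of largest absolute value. If the current scalar
  \<open>c\<close> takes the new entry \<open>f t\<close> out of \<open>R\<close>, then
  \<open>inverse (c * f t)\<close> lies in \<open>R\<close>, and dividing by \<open>f t\<close>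
  keeps the older entries in \<open>R\<close>, being multiplication of \<open>c * f s\<close> by
  that inverse.\<close>

lemma scale_primitive:
  assumes "finite S" "s \<in> S" "f s \<noteq> 0"
  shows "\<exists>c. c \<noteq> 0 \<and> (\<forall>s\<in>S. c * f s \<in> R) \<and> (\<exists>s\<in>S. c * f s = 1)"
  using assms
proof (induction S arbitrary: s)
  case (insert t S)
  show ?case
  proof (cases "\<exists>s\<in>S. f s \<noteq> 0")
    case False
    then show ?thesis
      using insert.prems zero_R one_R by (auto intro!: exI[of _ "inverse (f s)"])
  next
    case True
    then obtain c u where c: "c \<noteq> 0" "\<forall>s\<in>S. c * f s \<in> R" "u \<in> S" "c * f u = 1"
      using insert.IH by blast
    show ?thesis
    proof (cases "c * f t \<in> R")
      case False
      then have "f t \<noteq> 0" and inv: "inverse (c * f t) \<in> R"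
        using zero_R valuation by (metis mult_zero_right, blast)
      then have "inverse (f t) * f s \<in> R" if "s \<in> S" for s
        using mult_R[OF inv, of "c * f s"] c(1,2) that by (auto simp: field_simps)
      then show ?thesis
        using \<open>f t \<noteq> 0\<close> one_R by (intro exI[of _ "inverse (f t)"]) auto
    qed (use c in auto)
  qed
qed simp

text \<open>Vandermonde in Lagrange form. The integer polynomial \<open>Q\<close> vanishes on
  \<open>S\<close> except at \<open>w\<close> and has degree less than \<open>card S\<close>. If all
  these moments were in \<open>I\<close>, then so would be the combination of them with the
  coefficients of \<open>Q\<close>, which is \<open>poly Q w\<close>.\<close>

lemma exists_small_moment:
  assumes p: "prime p" and S: "finite S" "S \<subseteq> {0..<int p}"
    and a: "\<And>h. h \<in> S \<Longrightarrow> a h \<in> R" and one: "w \<in> S" "a w = 1"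
  shows "\<exists>i<card S. (\<Sum>h\<in>S. of_int (h ^ i) * a h) \<notin> I"
proof (rule ccontr)
  assume "\<not> ?thesis"
  then have small: "(\<Sum>h\<in>S. of_int (h ^ i) * a h) \<in> I" if "i < card S" for i
    using that by blast
  define Q where "Q = (\<Prod>v\<in>S - {w}. [:- v, 1:])"
  have "Polynomial.degree Q = card (S - {w})"
    unfolding Q_def by (subst degree_prod_eq_sum_degree) (auto simp: S)
  then have deg: "Polynomial.degree Q < card S"
    using S one by (metis card_Diff1_less)
  have Q: "poly Q h = (\<Prod>v\<in>S - {w}. h - v)" for h
    by (simp add: Q_def poly_prod)
  have "(\<Sum>h\<in>S. of_int (poly Q h) * a h)
      = (\<Sum>i\<le>Polynomial.degree Q. of_int (poly.coeff Q i) * (\<Sum>h\<in>S. of_int (h ^ i) * a h))"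
    unfolding poly_altdef of_int_sum of_int_mult sum_distrib_right sum_distrib_left
    by (subst sum.swap) (simp add: mult.assoc)
  also have "\<dots> \<in> I"
    using deg by (intro sum_I ideal_I of_int_R small) auto
  also have "(\<Sum>h\<in>S. of_int (poly Q h) * a h) = of_int (poly Q w) * a w"
    using S one by (subst sum.remove[of _ w]) (auto simp: Q intro!: sum.neutral)
  finally have "int p dvd poly Q w"
    using of_int_mem_I_iff[OF p] one by simp
  then obtain v where v: "v \<in> S" "v \<noteq> w" "int p dvd w - v"
    unfolding Q using prime_dvd_prod_iff[of "S - {w}" "int p"] S p by auto
  \<comment> \<open>Distinct representatives in the range from 0 to p - 1 are incongruent modulo
    \<open>p\<close>.\<close>
  have "v \<in> {0..<int p}" "w \<in> {0..<int p}" using S(2) one(1) v(1) by blast+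
  then have "\<bar>w - v\<bar> < int p" by (auto simp: abs_less_iff)
  then show False using v(2,3) dvd_imp_le_int[of "w - v" "int p"] by auto
qed

text \<open>Minimality of \<open>i\<close> is what later removes all but one term of a binomial
  expansion.\<close>

lemma exists_first_moment:
  assumes p: "prime p" and S: "finite S" "S \<subseteq> {0..<int p}"
    and a: "\<And>h. h \<in> S \<Longrightarrow> a h \<in> R" and one: "w \<in> S" "a w = 1"
  obtains i where "i < card S" "(\<Sum>h\<in>S. of_int (h ^ i) * a h) \<notin> I"
    "\<And>k. k < i \<Longrightarrow> (\<Sum>h\<in>S. of_int (h ^ k) * a h) \<in> I"
proof -
  define P where "P i \<longleftrightarrow> (\<Sum>h\<in>S. of_int (h ^ i) * a h) \<notin> I" for i
  obtain j where "j < card S" "P j"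
    using exists_small_moment[where S = S and a = a, OF assms] by (auto simp: P_def)
  moreover have "P (LEAST i. P i)" "(LEAST i. P i) \<le> j"
    using \<open>P j\<close> by (rule LeastI, rule Least_le)
  ultimately show thesis
    using that[of "LEAST i. P i"] not_less_Least[of _ P] by (auto simp: P_def)
qed

lemma no_orthogonal_pair_normalized:
  assumes p: "prime p" and \<alpha>: "coprime \<alpha> (int p)"
    and a: "\<And>h. h \<in> {0..<int p} \<Longrightarrow> a h \<in> R" and b: "\<And>g. g \<in> {0..<int p} \<Longrightarrow> b g \<in> R"
    and w: "w \<in> {0..<int p}" "a w = 1" and v: "v \<in> {0..<int p}" "b v = 1"
    and disjoint: "\<And>g. g \<in> {0..<int p} \<Longrightarrow> a g * b g = 0"
    and orth: "\<And>t. t \<in> {0..<int p} \<Longrightarrow> (\<Sum>h\<in>{0..<int p}. a h * b ((t - \<alpha> * h) mod int p)) = 0"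
  shows False
proof -
  let ?F = "{0..<int p}"
  have pi: "prime (int p)" using p by simp
  have p0: "int p > 0" using p by (simp add: prime_gt_0_nat)
  define M where "M i = (\<Sum>h\<in>?F. of_int (h ^ i) * a h)" for i
  define N where "N j = (\<Sum>g\<in>?F. of_int (g ^ j) * b g)" for j
  define A where "A = {h\<in>?F. a h \<noteq> 0}"
  define B where "B = {g\<in>?F. b g \<noteq> 0}"
  have sub: "A \<subseteq> ?F" "B \<subseteq> ?F"
    by (auto simp: A_def B_def)
  then have "finite A" "finite B"
    by (auto intro: finite_subset)
  moreover have "w \<in> A" "v \<in> B"
    using w v by (auto simp: A_def B_def)
  ultimately have AB: "finite A" "finite B" "A \<subseteq> ?F" "B \<subseteq> ?F" "w \<in> A" "v \<in> B"
    using sub by simp_all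
  \<comment> \<open>The bounds on the first moments outside \<open>I\<close> use the sizes of the
    supports, whereas the change of variable below needs sums over all residues; the added terms are
    0.\<close>
  have M: "M i = (\<Sum>h\<in>A. of_int (h ^ i) * a h)" for i
    unfolding M_def by (rule sum.mono_neutral_right) (auto simp: A_def)
  have N: "N i = (\<Sum>h\<in>B. of_int (h ^ i) * b h)" for i
    unfolding N_def by (rule sum.mono_neutral_right) (auto simp: B_def)
  have MR: "M i \<in> R" "N i \<in> R" for i
    unfolding M_def N_def by (intro sum_R mult_R of_int_R a b; assumption)+
  obtain i where i: "i < card A" "M i \<notin> I" "\<And>k. k < i \<Longrightarrow> M k \<in> I"
    using exists_first_moment[where a = a, OF p AB(1,3) _ AB(5) w(2)] AB(3) a unfolding M by blast
  obtain j where j: "j < card B" "N j \<notin> I" "\<And>k. k < j \<Longrightarrow> N k \<in> I"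
    using exists_first_moment[where a = b, OF p AB(2,4) _ AB(6) v(2)] AB(4) b unfolding N by blast
  define n where "n = i + j"
  \<comment> \<open>Disjoint supports have at most \<open>p\<close> elements together, and
    \<open>i\<close> and \<open>j\<close> are strictly below their sizes. The resulting bound
    \<open>n < p\<close> keeps the binomial coefficient prime to \<open>p\<close>.\<close>
  have "A \<inter> B = {}"
    using disjoint by (auto simp: A_def B_def)
  then have "card A + card B = card (A \<union> B)"
    using AB by (simp add: card_Un_disjoint)
  also have "\<dots> \<le> card ?F"
    using AB by (intro card_mono) auto
  finally have np: "n < p" using i j by (simp add: n_def)
  \<comment> \<open>The contribution of index \<open>k\<close> when (\<alpha> h + g)^n is expanded
    binomially and summed against \<open>a h * b g\<close>; the sums over \<open>h\<close> and
    \<open>g\<close> separate into moments.\<close>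
  define C where "C k = of_nat (n choose k) * of_int (\<alpha> ^ k) * (M k * N (n - k))" for k
  have "(\<Sum>k\<le>n. C k) = (\<Sum>h\<in>?F. \<Sum>g\<in>?F. of_int ((\<alpha> * h + g) ^ n) * (a h * b g))"
  proof -
    have "C k = (\<Sum>h\<in>?F. \<Sum>g\<in>?F. of_int (of_nat (n choose k) * (\<alpha> * h) ^ k * g ^ (n - k)) * (a h * b g))" for k
      unfolding C_def M_def N_def unfolding sum_product unfolding sum_distrib_left
      by (intro sum.cong refl) (simp add: power_mult_distrib mult_ac)
    then have "(\<Sum>k\<le>n. C k) = (\<Sum>k\<le>n. \<Sum>h\<in>?F. \<Sum>g\<in>?F.
        of_int (of_nat (n choose k) * (\<alpha> * h) ^ k * g ^ (n - k)) * (a h * b g))"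
      by (simp only:)
    also have "\<dots> = (\<Sum>h\<in>?F. \<Sum>g\<in>?F. \<Sum>k\<le>n.
        of_int (of_nat (n choose k) * (\<alpha> * h) ^ k * g ^ (n - k)) * (a h * b g))"
      by (subst sum.swap) (rule sum.cong[OF refl], rule sum.swap)
    finally show ?thesis
      unfolding binomial_ring of_int_sum sum_distrib_right .
  qed
  also have "\<dots> = (\<Sum>h\<in>?F. \<Sum>t\<in>?F. of_int ((\<alpha> * h + (t - \<alpha> * h) mod int p) ^ n) *
      (a h * b ((t - \<alpha> * h) mod int p)))"
  proof (rule sum.cong[OF refl])
    fix h
    \<comment> \<open>For fixed \<open>h\<close>, the variable \<open>g\<close> is replaced by the
      residue \<open>t\<close> of \<alpha> h + g.\<close>
    have "bij_betw (\<lambda>t. (t - \<alpha> * h) mod int p) ?F ?F"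
      by (rule bij_betw_byWitness[where f' = "\<lambda>g. (g + \<alpha> * h) mod int p"])
        (use p0 in \<open>auto simp: mod_simps\<close>)
    from sum.reindex_bij_betw[OF this, of "\<lambda>g. of_int ((\<alpha> * h + g) ^ n) * (a h * b g)"]
    show "(\<Sum>g\<in>?F. of_int ((\<alpha> * h + g) ^ n) * (a h * b g)) = (\<Sum>t\<in>?F.
        of_int ((\<alpha> * h + (t - \<alpha> * h) mod int p) ^ n) * (a h * b ((t - \<alpha> * h) mod int p)))"
      by (rule sym)
  qed
  \<comment> \<open>The base of the power is only congruent to \<open>t\<close>. Replacing it by
    \<open>t\<close> costs an error divisible by \<open>p\<close>, hence in \<open>I\<close>; after
    that the power no longer depends on \<open>h\<close>, and the inner sum over \<open>h\<close> is
    a convolution equation.\<close>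
  also have "\<dots> = (\<Sum>h\<in>?F. \<Sum>t\<in>?F. of_int ((\<alpha> * h + (t - \<alpha> * h) mod int p) ^ n - t ^ n) *
      (a h * b ((t - \<alpha> * h) mod int p)))
    + (\<Sum>h\<in>?F. \<Sum>t\<in>?F. of_int (t ^ n) * (a h * b ((t - \<alpha> * h) mod int p)))"
    unfolding sum.distrib[symmetric] distrib_right[symmetric] of_int_add[symmetric] by simp
  also have "(\<Sum>h\<in>?F. \<Sum>t\<in>?F. of_int (t ^ n) * (a h * b ((t - \<alpha> * h) mod int p)))
      = (\<Sum>t\<in>?F. of_int (t ^ n) * (\<Sum>h\<in>?F. a h * b ((t - \<alpha> * h) mod int p)))"
    unfolding sum_distrib_left by (rule sum.swap)
  also have "\<dots> = 0"
    by (intro sum.neutral ballI) (simp only: orth mult_zero_right)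
  also have "(\<Sum>h\<in>?F. \<Sum>t\<in>?F. of_int ((\<alpha> * h + (t - \<alpha> * h) mod int p) ^ n - t ^ n) *
      (a h * b ((t - \<alpha> * h) mod int p))) + 0 \<in> I"
    unfolding add_0_right
  proof (intro sum_I)
    fix h t assume ht: "h \<in> ?F" "t \<in> ?F"
    have "[\<alpha> * h + (t - \<alpha> * h) mod int p = t] (mod int p)"
      by (simp add: cong_def mod_simps)
    then have "int p dvd (\<alpha> * h + (t - \<alpha> * h) mod int p) ^ n - t ^ n"
      using cong_pow cong_iff_dvd_diff by blast
    then have "of_int ((\<alpha> * h + (t - \<alpha> * h) mod int p) ^ n - t ^ n) \<in> I"
      by (rule of_int_mem_I)
    moreover have "a h * b ((t - \<alpha> * h) mod int p) \<in> R"
      using ht p0 by (intro mult_R a b) auto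
    ultimately show "of_int ((\<alpha> * h + (t - \<alpha> * h) mod int p) ^ n - t ^ n) *
        (a h * b ((t - \<alpha> * h) mod int p)) \<in> I"
      by (metis ideal_I mult.commute)
  qed
  finally have "(\<Sum>k\<le>n. C k) \<in> I" .
  moreover have "(\<Sum>k\<in>{..n} - {i}. C k) \<in> I"
  proof (rule sum_I)
    fix k assume "k \<in> {..n} - {i}"
    \<comment> \<open>As the indices of the two moments add up to \<open>i + j\<close>, any
      \<open>k\<close> other than \<open>i\<close> puts one of them below its first value outside
      \<open>I\<close>.\<close>
    then consider "k < i" | "n - k < j" by (fastforce simp: n_def)
    then have "M k * N (n - k) \<in> I"
    proof cases
      case 1
      then have "N (n - k) * M k \<in> I" by (intro ideal_I MR i(3))
      then show ?thesis by (simp only: mult.commute)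
    qed (intro ideal_I MR j(3))
    then show "C k \<in> I"
      unfolding C_def by (rule ideal_I[OF mult_R[OF of_nat_R of_int_R]])
  qed
  ultimately have "(\<Sum>k\<le>n. C k) - (\<Sum>k\<in>{..n} - {i}. C k) \<in> I"
    by (rule diff_I)
  moreover have "(\<Sum>k\<le>n. C k) = C i + (\<Sum>k\<in>{..n} - {i}. C k)"
    by (rule sum.remove) (simp_all add: n_def)
  ultimately have "C i \<in> I"
    by simp
  then have "of_int (int (n choose i) * \<alpha> ^ i) * (M i * N j) \<in> I"
    by (simp add: C_def n_def)
  then have "of_int (int (n choose i) * \<alpha> ^ i) \<in> I \<or> M i * N j \<in> I"
    by (rule prime_I[OF of_int_R mult_R[OF MR]])
  moreover have "M i * N j \<notin> I"
    using prime_I[OF MR] i(2) j(2) by blast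
  \<comment> \<open>The binomial coefficient divides \<open>fact n\<close> with
    \<open>n < p\<close>, and \<alpha> is a unit modulo \<open>p\<close>, so the surviving term
    \<open>C i\<close> cannot lie in \<open>I\<close>.\<close>
  moreover have "\<not> int p dvd int (n choose i) * \<alpha> ^ i"
  proof -
    have "\<not> p dvd n choose i"
    proof
      assume "p dvd n choose i"
      then have "p dvd fact i * fact (n - i) * (n choose i)"
        by (rule dvd_mult)
      moreover have "fact i * fact (n - i) * (n choose i) = fact n"
        by (rule binomial_fact_lemma) (simp add: n_def)
      ultimately have "p dvd fact n"
        by (simp only:)
      then show False
        unfolding prime_dvd_fact_iff[OF p] using np by linarith
    qed
    moreover have "\<not> int p dvd \<alpha> ^ i"
    proof
      assume "int p dvd \<alpha> ^ i"
      then have "int p dvd \<alpha>"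
        by (rule prime_dvd_power[OF pi])
      then have "is_unit (int p)"
        by (rule coprime_common_divisor[OF \<alpha>]) simp
      then show False
        using p by simp
    qed
    ultimately show ?thesis
      unfolding prime_dvd_mult_iff[OF pi] int_dvd_int_iff by blast
  qed
  ultimately show False
    unfolding of_int_mem_I_iff[OF p] by blast
qed

end

text \<open>The equations are homogeneous in \<open>a\<close> and in \<open>b\<close> separately, so
  each function may be scaled on its own to have entries in \<open>R\<close> and one entry equal to
  1.\<close>

theorem no_orthogonal_pair:
  fixes a b :: "int \<Rightarrow> 'k::field_char_0"
  assumes p: "prime p" and \<alpha>: "coprime \<alpha> (int p)"
    and w: "w \<in> {0..<int p}" "a w \<noteq> 0" and v: "v \<in> {0..<int p}" "b v \<noteq> 0"
    and disjoint: "\<And>g. g \<in> {0..<int p} \<Longrightarrow> a g * b g = 0"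
    and orth: "\<And>t. t \<in> {0..<int p} \<Longrightarrow> (\<Sum>h\<in>{0..<int p}. a h * b ((t - \<alpha> * h) mod int p)) = 0"
  shows False
proof -
  obtain R I :: "'k set" where "place R I p"
    using place_exists[OF p] by blast
  then interpret place R I p .
  obtain c w' where c: "\<forall>h\<in>{0..<int p}. c * a h \<in> R" "w' \<in> {0..<int p}" "c * a w' = 1"
    using scale_primitive[of "{0..<int p}" w a] w by auto
  obtain d v' where d: "\<forall>h\<in>{0..<int p}. d * b h \<in> R" "v' \<in> {0..<int p}" "d * b v' = 1"
    using scale_primitive[of "{0..<int p}" v b] v by auto
  show False
  proof (rule no_orthogonal_pair_normalized[OF p \<alpha>, of "\<lambda>h. c * a h" "\<lambda>g. d * b g" w' v'])
    fix t assume t: "t \<in> {0..<int p}"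
    have "(\<Sum>h\<in>{0..<int p}. c * a h * (d * b ((t - \<alpha> * h) mod int p)))
        = c * d * (\<Sum>h\<in>{0..<int p}. a h * b ((t - \<alpha> * h) mod int p))"
      unfolding sum_distrib_left by (intro sum.cong refl) (simp add: mult_ac)
    then show "(\<Sum>h\<in>{0..<int p}. c * a h * (d * b ((t - \<alpha> * h) mod int p))) = 0"
      using orth[OF t] by simp
  qed (use c d disjoint in auto)
qed

section \<open>Linear maps of the tensor algebra and the Nichols ideal\<close>

definition fin_supp :: "('a \<Rightarrow> 'k::zero) \<Rightarrow> bool" where
  "fin_supp f \<longleftrightarrow> finite {w. f w \<noteq> 0}"

text \<open>The operators are total on functions, but \<open>lin_ext\<close> sums over the support,
  and the sum over an infinite set is 0 by convention; linearity can therefore be expected only for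
  finite supports.\<close>

definition fs_linear :: "(('a \<Rightarrow> 'k::field) \<Rightarrow> 'b \<Rightarrow> 'k) \<Rightarrow> bool" where
  "fs_linear P \<longleftrightarrow> (\<forall>c f g. fin_supp f \<longrightarrow> fin_supp g \<longrightarrow>
     P (\<lambda>w. c * f w + g w) = (\<lambda>v. c * P f v + P g v))"

lemma fs_linearD:
  "fs_linear P \<Longrightarrow> fin_supp f \<Longrightarrow> fin_supp g \<Longrightarrow> P (\<lambda>w. c * f w + g w) = (\<lambda>v. c * P f v + P g v)"
  by (simp add: fs_linear_def)

lemma fin_supp_zero [simp]: "fin_supp (\<lambda>_. 0)"
  by (simp add: fin_supp_def)

text \<open>Taking \<open>c = -1\<close> and both arguments zero gives
  \<open>- P 0 + P 0\<close>.\<close>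

lemma fs_linear_zero: "fs_linear P \<Longrightarrow> P (\<lambda>_. 0) = (\<lambda>_. 0)"
  using fs_linearD[of P "\<lambda>_. 0" "\<lambda>_. 0" "-1"] by simp

lemma fin_supp_lincomb:
  fixes f g :: "'a \<Rightarrow> 'k::field"
  assumes "fin_supp f" "fin_supp g"
  shows "fin_supp (\<lambda>w. c * f w + g w)"
proof -
  have "{w. c * f w + g w \<noteq> 0} \<subseteq> {w. f w \<noteq> 0} \<union> {w. g w \<noteq> 0}" by auto
  then show ?thesis
    using assms unfolding fin_supp_def by (meson finite_UnI finite_subset)
qed

lemma fin_supp_word [simp]: "fin_supp (word w :: 'x list \<Rightarrow> 'k::field)"
  unfolding fin_supp_def by (rule finite_subset[of _ "{w}"]) (auto simp: word_def)

lemma fin_supp_sum: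
  fixes f :: "'s \<Rightarrow> 'a \<Rightarrow> 'k::field"
  assumes "finite S" "\<And>s. s \<in> S \<Longrightarrow> fin_supp (f s)"
  shows "fin_supp (\<lambda>w. \<Sum>s\<in>S. f s w)"
  using assms
proof (induction S)
  case (insert s S)
  then have "fin_supp (\<lambda>w. 1 * f s w + (\<Sum>s\<in>S. f s w))"
    by (intro fin_supp_lincomb) auto
  then show ?case using insert.hyps by simp
qed simp

lemma fs_linear_comp:
  "fs_linear P \<Longrightarrow> fs_linear Q \<Longrightarrow> (\<And>f. fin_supp f \<Longrightarrow> fin_supp (Q f)) \<Longrightarrow> fs_linear (P \<circ> Q)"
  by (simp add: fs_linear_def)

lemma fs_linear_sum:
  fixes P :: "'s \<Rightarrow> ('a \<Rightarrow> 'k::field) \<Rightarrow> 'b \<Rightarrow> 'k"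
  assumes "\<And>s. s \<in> S \<Longrightarrow> fs_linear (P s)"
  shows "fs_linear (\<lambda>f w. \<Sum>s\<in>S. P s f w)"
  unfolding fs_linear_def
proof (intro allI impI ext)
  fix c :: 'k and f g :: "'a \<Rightarrow> 'k" and v assume "fin_supp f" "fin_supp g"
  then have "(\<Sum>s\<in>S. P s (\<lambda>w. c * f w + g w) v) = (\<Sum>s\<in>S. c * P s f v + P s g v)"
    using assms by (intro sum.cong) (auto simp: fs_linear_def)
  then show "(\<Sum>s\<in>S. P s (\<lambda>w. c * f w + g w) v) = c * (\<Sum>s\<in>S. P s f v) + (\<Sum>s\<in>S. P s g v)"
    by (simp only: sum.distrib sum_distrib_left)
qed

lemma lin_ext_eq_sum:
  assumes "finite S" "{w. f w \<noteq> 0} \<subseteq> S"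
  shows "lin_ext \<phi> f v = (\<Sum>w\<in>S. f w * \<phi> w v)"
  unfolding lin_ext_def by (rule sum.mono_neutral_left) (use assms in auto)

lemma fs_linear_lin_ext:
  fixes \<phi> :: "'x list \<Rightarrow> 'x list \<Rightarrow> 'k::field"
  shows "fs_linear (lin_ext \<phi>)"
  unfolding fs_linear_def
proof (intro allI impI ext)
  fix c :: 'k and f g :: "'x list \<Rightarrow> 'k" and v assume fg: "fin_supp f" "fin_supp g"
  let ?S = "{w. f w \<noteq> 0} \<union> {w. g w \<noteq> 0}"
  have S: "finite ?S" using fg by (simp add: fin_supp_def)
  have "lin_ext \<phi> (\<lambda>w. c * f w + g w) v = (\<Sum>w\<in>?S. (c * f w + g w) * \<phi> w v)"
    by (rule lin_ext_eq_sum[OF S]) auto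
  moreover have "lin_ext \<phi> f v = (\<Sum>w\<in>?S. f w * \<phi> w v)" "lin_ext \<phi> g v = (\<Sum>w\<in>?S. g w * \<phi> w v)"
    by (rule lin_ext_eq_sum[OF S]; auto)+
  ultimately show "lin_ext \<phi> (\<lambda>w. c * f w + g w) v = c * lin_ext \<phi> f v + lin_ext \<phi> g v"
    by (simp only: sum_distrib_left sum.distrib[symmetric] distrib_right mult.assoc)
qed

lemma lin_ext_word: "lin_ext \<phi> (word u) = \<phi> u"
proof
  fix v
  show "lin_ext \<phi> (word u) v = \<phi> u v"
    by (subst lin_ext_eq_sum[of "{u}"]) (auto simp: word_def)
qed

lemma lin_ext_sum_words:
  assumes "finite S"
  shows "lin_ext \<phi> (\<lambda>w. \<Sum>s\<in>S. word (u s) w) = (\<lambda>v. \<Sum>s\<in>S. \<phi> (u s) v)"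
  using assms
proof (induction S)
  case empty
  show ?case by (simp add: fs_linear_zero[OF fs_linear_lin_ext])
next
  case (insert s S)
  have "lin_ext \<phi> (\<lambda>w. 1 * word (u s) w + (\<Sum>s\<in>S. word (u s) w))
      = (\<lambda>v. 1 * lin_ext \<phi> (word (u s)) v + lin_ext \<phi> (\<lambda>w. \<Sum>s\<in>S. word (u s) w) v)"
    by (intro fs_linearD[OF fs_linear_lin_ext] fin_supp_sum insert.hyps fin_supp_word)
  then show ?case using insert by (simp add: lin_ext_word)
qed

section \<open>Linearity of the braiding operators and the quantum symmetrizers\<close>

lemma fs_linear_braid_at: "fs_linear (braid_at op q i)"
  unfolding braid_at_def by (rule fs_linear_lin_ext)

lemma fin_supp_braid_at:
  assumes "fin_supp f"
  shows "fin_supp (braid_at op q i f)"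
proof -
  have "{v. braid_at op q i f v \<noteq> 0}
      \<subseteq> (\<lambda>w. w[i := op (w ! i) (w ! Suc i), Suc i := w ! i]) ` {w. f w \<noteq> 0}"
  proof
    fix v assume "v \<in> {v. braid_at op q i f v \<noteq> 0}"
    then obtain w where "f w \<noteq> 0" "word (w[i := op (w ! i) (w ! Suc i), Suc i := w ! i]) v \<noteq> (0 :: 'b)"
      unfolding braid_at_def lin_ext_def by (force elim: sum.not_neutral_contains_not_neutral)
    then show "v \<in> (\<lambda>w. w[i := op (w ! i) (w ! Suc i), Suc i := w ! i]) ` {w. f w \<noteq> 0}"
      by (auto simp: word_def split: if_splits)
  qed
  then show ?thesis
    using assms unfolding fin_supp_def by (meson finite_imageI finite_subset)
qed

lemma fin_supp_braid_prod: "fin_supp f \<Longrightarrow> fin_supp (braid_prod op q j f)"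
  by (induction j arbitrary: f) (simp_all add: fin_supp_braid_at)

lemma fs_linear_braid_prod: "fs_linear (braid_prod op q j)"
proof (induction j)
  case 0
  show ?case by (simp add: fs_linear_def)
next
  case (Suc j)
  then show ?case
    unfolding braid_prod.simps by (intro fs_linear_comp fs_linear_braid_at fin_supp_braid_at)
qed

lemma fin_supp_slice:
  assumes "fin_supp f"
  shows "fin_supp (\<lambda>u. f (y # u))"
proof -
  have "finite ((#) y -` {w. f w \<noteq> 0})"
    using assms unfolding fin_supp_def by (rule finite_vimageI) simp
  then show ?thesis by (simp add: fin_supp_def vimage_def)
qed

lemma fs_linear_id_tensor:
  fixes P :: "('x list \<Rightarrow> 'k::field) \<Rightarrow> 'x list \<Rightarrow> 'k"
  assumes "fs_linear P"
  shows "fs_linear (id_tensor P)"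
  unfolding fs_linear_def
proof (intro allI impI ext)
  fix c :: 'k and f g :: "'x list \<Rightarrow> 'k" and v assume fg: "fin_supp f" "fin_supp g"
  have "P (\<lambda>u. c * f (y # u) + g (y # u)) = (\<lambda>v. c * P (\<lambda>u. f (y # u)) v + P (\<lambda>u. g (y # u)) v)" for y
    by (intro fs_linearD[OF assms] fin_supp_slice fg)
  then show "id_tensor P (\<lambda>w. c * f w + g w) v = c * id_tensor P f v + id_tensor P g v"
    by (simp add: id_tensor_def split: list.split)
qed

lemma fs_linear_quantum_sym: "fs_linear (quantum_sym op q n)"
proof (induction op q n rule: quantum_sym.induct)
  case (3 op q n)
  then show ?case
    unfolding quantum_sym.simps
    by (intro fs_linear_comp fs_linear_id_tensor fs_linear_sum fs_linear_braid_prod fin_supp_sum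
        fin_supp_braid_prod) auto
qed (simp_all add: fs_linear_def)

lemma fin_supp_hom_part: "fin_supp f \<Longrightarrow> fin_supp (hom_part n f)"
  unfolding fin_supp_def hom_part_def by (rule finite_subset[rotated]) auto

lemma hom_part_lincomb:
  "hom_part n (\<lambda>w. c * f w + g w) = (\<lambda>w. c * hom_part n f w + hom_part n g w)"
  by (auto simp: hom_part_def)

section \<open>Elements of the tensor algebra\<close>

lemma tensor_carrier: "f \<in> carrier (tensor_algebra X) \<longleftrightarrow> fin_supp f \<and> {w. f w \<noteq> 0} \<subseteq> lists X"
  by (simp add: tensor_algebra_def fin_supp_def)

lemma tensor_lincomb_closed:
  assumes "f \<in> carrier (tensor_algebra X)" "g \<in> carrier (tensor_algebra X)"
  shows "(\<lambda>w. c * f w + g w) \<in> carrier (tensor_algebra X)"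
proof -
  have "{w. c * f w + g w \<noteq> 0} \<subseteq> {w. f w \<noteq> 0} \<union> {w. g w \<noteq> 0}" by auto
  then show ?thesis
    using assms fin_supp_lincomb unfolding tensor_carrier by blast
qed

lemma tensor_zero_closed: "(\<lambda>_. 0) \<in> carrier (tensor_algebra X)"
  by (simp add: tensor_carrier)

lemma tensor_smult_closed:
  "f \<in> carrier (tensor_algebra X) \<Longrightarrow> (\<lambda>w. c * f w) \<in> carrier (tensor_algebra X)"
  using tensor_lincomb_closed[OF _ tensor_zero_closed] by fastforce

lemma tensor_add_closed:
  "f \<in> carrier (tensor_algebra X) \<Longrightarrow> g \<in> carrier (tensor_algebra X) \<Longrightarrow>
    (\<lambda>w. f w + g w) \<in> carrier (tensor_algebra X)"
  using tensor_lincomb_closed[of f X g 1] by simp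

lemma word_closed: "w \<in> lists X \<Longrightarrow> word w \<in> carrier (tensor_algebra X)"
  using fin_supp_word[of w] unfolding tensor_carrier by (simp add: word_def)

lemma tensor_sum_closed:
  assumes "finite S" "\<And>s. s \<in> S \<Longrightarrow> f s \<in> carrier (tensor_algebra X)"
  shows "(\<lambda>w. \<Sum>s\<in>S. f s w) \<in> carrier (tensor_algebra X)"
  using assms
proof (induction S)
  case (insert s S)
  then show ?case using tensor_add_closed[of "f s" X "\<lambda>w. \<Sum>s\<in>S. f s w"] by simp
qed (simp add: tensor_zero_closed)

text \<open>Words span, so coefficients can be removed one word at a time. The induction runs over a
  finite set containing the support, so the coefficient removed may be 0.\<close>

lemma tensor_induct [consumes 1, case_names zero add]:
  fixes f :: "'x list \<Rightarrow> 'k::field"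
  assumes "f \<in> carrier (tensor_algebra X)"
    and zero: "P (\<lambda>_. 0)"
    and add: "\<And>c w f. w \<in> lists X \<Longrightarrow> f \<in> carrier (tensor_algebra X) \<Longrightarrow> P f \<Longrightarrow>
      P (\<lambda>v. c * word w v + f v)"
  shows "P f"
proof -
  have "P f" if "finite S" "{w. f w \<noteq> 0} \<subseteq> S" "S \<subseteq> lists X" for S and f :: "'x list \<Rightarrow> 'k"
    using that
  proof (induction S arbitrary: f)
    case empty
    then have "f = (\<lambda>_. 0)" by auto
    then show ?case using zero by simp
  next
    case (insert w S)
    define g where "g = f(w := 0)"
    have g: "{v. g v \<noteq> 0} \<subseteq> S" using insert.prems(1) by (auto simp: g_def)
    have "g \<in> carrier (tensor_algebra X)"
      unfolding tensor_carrier fin_supp_def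
      using finite_subset[OF g insert.hyps(1)] g insert.prems(2) by blast
    moreover have "P g"
      using insert.IH[OF g] insert.prems(2) by simp
    ultimately have "P (\<lambda>v. f w * word w v + g v)"
      using insert.prems(2) add by simp
    moreover have "(\<lambda>v. f w * word w v + g v) = f"
      by (auto simp: word_def g_def)
    ultimately show ?case by simp
  qed
  then show ?thesis using assms(1) by (auto simp: tensor_carrier fin_supp_def)
qed

lemma abelian_group_tensor_algebra:
  "abelian_group (tensor_algebra X :: ('k::field, 'x list \<Rightarrow> 'k) module)"
proof (rule abelian_groupI)
  fix f :: "'x list \<Rightarrow> 'k" assume f: "f \<in> carrier (tensor_algebra X :: ('k, 'x list \<Rightarrow> 'k) module)"
  show "\<exists>g\<in>carrier (tensor_algebra X). g \<oplus>\<^bsub>tensor_algebra X\<^esub> f = \<zero>\<^bsub>tensor_algebra X\<^esub>"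
    using tensor_smult_closed[OF f, of "-1"]
    by (intro bexI[of _ "\<lambda>w. -1 * f w"]) (simp_all add: tensor_algebra_def)
qed (use tensor_add_closed[of _ X] tensor_zero_closed[of X] in \<open>auto simp: tensor_algebra_def add_ac\<close>)

section \<open>The Nichols ideal and its quadratic elements\<close>

lemma nichols_ideal_lincomb:
  assumes "f \<in> nichols_ideal X op q" "g \<in> nichols_ideal X op q"
  shows "(\<lambda>w. c * f w + g w) \<in> nichols_ideal X op q"
proof -
  have "fin_supp f" "fin_supp g"
    using assms by (simp_all add: nichols_ideal_def tensor_carrier)
  then have "quantum_sym op q n (hom_part n (\<lambda>w. c * f w + g w))
      = (\<lambda>v. c * quantum_sym op q n (hom_part n f) v + quantum_sym op q n (hom_part n g) v)" for n
    unfolding hom_part_lincomb by (intro fs_linearD[OF fs_linear_quantum_sym] fin_supp_hom_part)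
  then show ?thesis
    using assms tensor_lincomb_closed[of f X g c] by (simp add: nichols_ideal_def)
qed

lemma nichols_ideal_zero: "(\<lambda>_. 0) \<in> nichols_ideal X op q"
  by (simp add: nichols_ideal_def tensor_zero_closed hom_part_def fs_linear_zero[OF fs_linear_quantum_sym])

lemma nichols_ideal_smult: "f \<in> nichols_ideal X op q \<Longrightarrow> (\<lambda>w. c * f w) \<in> nichols_ideal X op q"
  using nichols_ideal_lincomb[OF _ nichols_ideal_zero] by fastforce

lemma tensor_uminus:
  assumes "f \<in> carrier (tensor_algebra X)"
  shows "\<ominus>\<^bsub>tensor_algebra X\<^esub> f = (\<lambda>w. - f w)"
proof -
  interpret abelian_group "tensor_algebra X" by (rule abelian_group_tensor_algebra)
  show ?thesis
    using tensor_smult_closed[OF assms, of "-1"]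
    by (intro minus_equality assms) (simp_all add: tensor_algebra_def)
qed

lemma abelian_subgroup_nichols_ideal:
  "abelian_subgroup (nichols_ideal X op q) (tensor_algebra X)"
proof (rule abelian_subgroupI3)
  interpret abelian_group "tensor_algebra X" by (rule abelian_group_tensor_algebra)
  show "additive_subgroup (nichols_ideal X op q) (tensor_algebra X)"
  proof (intro additive_subgroup.intro add.subgroupI)
    fix f assume f: "f \<in> nichols_ideal X op q"
    then have "\<ominus>\<^bsub>tensor_algebra X\<^esub> f = (\<lambda>w. - 1 * f w)"
      by (subst tensor_uminus) (auto simp: nichols_ideal_def)
    then show "\<ominus>\<^bsub>tensor_algebra X\<^esub> f \<in> nichols_ideal X op q"
      using nichols_ideal_smult[OF f, of "- 1"] by simp
  next
    fix f g assume "f \<in> nichols_ideal X op q" "g \<in> nichols_ideal X op q"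
    then show "f \<oplus>\<^bsub>tensor_algebra X\<^esub> g \<in> nichols_ideal X op q"
      using nichols_ideal_lincomb[of f X op q g 1] by (simp add: tensor_algebra_def)
  next
    show "nichols_ideal X op q \<noteq> {}" using nichols_ideal_zero by blast
  qed (simp add: nichols_ideal_def subset_iff)
qed (rule abelian_group_tensor_algebra)

text \<open>The braiding sends \<open>[\<sigma> h, h]\<close> to minus
  \<open>[\<sigma> (\<sigma> h), \<sigma> h]\<close>, so reindexing along \<open>\<sigma>\<close>
  shows that the sum is mapped to its negative. It is applied to the identity on a singleton and to
  the map from h to t - \<alpha> h on all residues.\<close>

lemma word_pair_sum_mem_nichols_ideal:
  assumes "finite S" "S \<subseteq> X" and \<sigma>: "bij_betw \<sigma> S S" and op: "\<And>h. h \<in> S \<Longrightarrow> op (\<sigma> h) h = \<sigma> (\<sigma> h)"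
  shows "(\<lambda>w. \<Sum>h\<in>S. word [\<sigma> h, h] w) \<in> nichols_ideal X op (\<lambda>_ _. - 1 :: 'k::field)"
    (is "?r \<in> nichols_ideal X op ?q")
proof -
  have \<sigma>X: "\<sigma> h \<in> X" if "h \<in> S" for h
    using that assms(2) \<sigma> by (meson bij_betwE subsetD)
  have r: "?r \<in> carrier (tensor_algebra X)"
    by (intro tensor_sum_closed word_closed assms(1)) (use \<sigma>X assms(2) in auto)
  have "braid_at op ?q 0 ?r v = - ?r v" for v
  proof -
    have "braid_at op ?q 0 ?r v = (\<Sum>h\<in>S. - word [op (\<sigma> h) h, \<sigma> h] v)"
      unfolding braid_at_def lin_ext_sum_words[OF assms(1)] by simp
    also have "\<dots> = (\<Sum>h\<in>S. - word [\<sigma> (\<sigma> h), \<sigma> h] v)"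
      by (rule sum.cong) (simp_all add: op)
    also have "\<dots> = - ?r v"
      unfolding sum_negf using sum.reindex_bij_betw[OF \<sigma>, of "\<lambda>h. word [\<sigma> h, h] v"] by simp
    finally show ?thesis .
  qed
  \<comment> \<open>The sum over \<open>j\<close> is the operator I + c_1, and the remaining factor
    of the symmetrizer preserves 0.\<close>
  then have "(\<lambda>w. \<Sum>j\<le>Suc 0. braid_prod op ?q j ?r w) = (\<lambda>_. 0)"
    by simp
  then have "quantum_sym op ?q 2 ?r = (\<lambda>_. 0)"
    unfolding numeral_2_eq_2 quantum_sym.simps comp_def
    by (simp add: id_tensor_def fun_eq_iff split: list.split)
  \<comment> \<open>The sum is homogeneous of degree 2, so the other symmetrizers only see
    0.\<close>
  moreover have "hom_part n ?r = (if n = 2 then ?r else (\<lambda>_. 0))" for n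
    by (auto simp: hom_part_def word_def fun_eq_iff intro!: sum.neutral)
  ultimately have "quantum_sym op ?q n (hom_part n ?r) = (\<lambda>_. 0)" for n
    by (simp add: fs_linear_zero[OF fs_linear_quantum_sym])
  with r show ?thesis by (simp add: nichols_ideal_def)
qed

section \<open>Modules over Nichols algebras\<close>

context left_module
begin

lemma smult_zero_left:
  assumes "x \<in> carrier M"
  shows "\<zero>\<^bsub>R\<^esub> \<odot>\<^bsub>M\<^esub> x = \<zero>\<^bsub>M\<^esub>"
proof -
  have "\<zero>\<^bsub>R\<^esub> \<odot>\<^bsub>M\<^esub> x \<oplus>\<^bsub>M\<^esub> \<zero>\<^bsub>R\<^esub> \<odot>\<^bsub>M\<^esub> x = \<zero>\<^bsub>R\<^esub> \<odot>\<^bsub>M\<^esub> x"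
    using smult_l_distr[of "\<zero>\<^bsub>R\<^esub>" "\<zero>\<^bsub>R\<^esub>" x] assms by simp
  then show ?thesis
    using M.add.l_cancel_one smult_closed assms by (metis R.zero_closed)
qed

lemma smult_zero_right:
  assumes "a \<in> carrier R"
  shows "a \<odot>\<^bsub>M\<^esub> \<zero>\<^bsub>M\<^esub> = \<zero>\<^bsub>M\<^esub>"
proof -
  have "a \<odot>\<^bsub>M\<^esub> \<zero>\<^bsub>M\<^esub> \<oplus>\<^bsub>M\<^esub> a \<odot>\<^bsub>M\<^esub> \<zero>\<^bsub>M\<^esub> = a \<odot>\<^bsub>M\<^esub> \<zero>\<^bsub>M\<^esub>"
    using smult_r_distr[of a "\<zero>\<^bsub>M\<^esub>" "\<zero>\<^bsub>M\<^esub>"] assms by simp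
  then show ?thesis
    using M.add.l_cancel_one smult_closed assms by (metis M.zero_closed)
qed

end

lemma (in graded_left_module) grade_closed: "x \<in> grade M i \<Longrightarrow> x \<in> carrier M"
  using additive_subgroup.a_subset[OF grade_subgroup] by blast

lemma (in graded_left_module) grade_zero: "\<zero>\<^bsub>M\<^esub> \<in> grade M i"
  using additive_subgroup.zero_closed[OF grade_subgroup] .

text \<open>The family with values \<open>x\<close>, \<open>y\<close>, \<open>z\<close> in degrees
  0, 1, 2 decomposes 0, as does the zero family; uniqueness in \<open>grade_decomp\<close>
  identifies them.\<close>

lemma (in graded_left_module) grade_independent:
  assumes "x \<in> grade M 0" "y \<in> grade M 1" "z \<in> grade M 2"
    and sum: "x \<oplus>\<^bsub>M\<^esub> (y \<oplus>\<^bsub>M\<^esub> z) = \<zero>\<^bsub>M\<^esub>"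
  shows "x = \<zero>\<^bsub>M\<^esub>" "y = \<zero>\<^bsub>M\<^esub>" "z = \<zero>\<^bsub>M\<^esub>"
proof -
  define f where "f i = (if i = 0 then x else if i = 1 then y else if i = (2::nat) then z else \<zero>\<^bsub>M\<^esub>)" for i
  have carr: "x \<in> carrier M" "y \<in> carrier M" "z \<in> carrier M"
    using assms grade_closed by blast+
  have f: "f i \<in> grade M i" "f i \<in> carrier M" for i
    using assms carr grade_zero by (auto simp: f_def)
  have supp: "{i. f i \<noteq> \<zero>\<^bsub>M\<^esub>} \<subseteq> {0, 1, 2}"
    by (auto simp: f_def)
  have "finsum M f {i. f i \<noteq> \<zero>\<^bsub>M\<^esub>} = finsum M f {0, 1, 2}"
    by (rule M.add.finprod_mono_neutral_cong_left) (use f supp in auto)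
  also have "\<dots> = x \<oplus>\<^bsub>M\<^esub> (y \<oplus>\<^bsub>M\<^esub> z)"
    using carr by (simp add: f_def)
  finally have "\<zero>\<^bsub>M\<^esub> = finsum M f {i. f i \<noteq> \<zero>\<^bsub>M\<^esub>}"
    using sum by simp
  moreover have "finite {i. f i \<noteq> \<zero>\<^bsub>M\<^esub>}"
    by (rule finite_subset[OF supp]) simp
  moreover have "\<exists>!f. (\<forall>i. f i \<in> grade M i) \<and> finite {i. f i \<noteq> \<zero>\<^bsub>M\<^esub>} \<and>
      \<zero>\<^bsub>M\<^esub> = finsum M f {i. f i \<noteq> \<zero>\<^bsub>M\<^esub>}"
    by (rule grade_decomp) simp
  ultimately have "f = (\<lambda>_. \<zero>\<^bsub>M\<^esub>)"
    using f(1) grade_zero by (elim ex1E) (metis (mono_tags, lifting) M.finsum_empty empty_Collect_eq finite.emptyI)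
  then have "f 0 = \<zero>\<^bsub>M\<^esub>" "f 1 = \<zero>\<^bsub>M\<^esub>" "f 2 = \<zero>\<^bsub>M\<^esub>" by simp_all
  then show "x = \<zero>\<^bsub>M\<^esub>" "y = \<zero>\<^bsub>M\<^esub>" "z = \<zero>\<^bsub>M\<^esub>" by (simp_all add: f_def)
qed

section \<open>The action of the Nichols algebra through representatives\<close>

locale nichols_module =
  graded_left_module "nichols_algebra X op q" M
  for X :: "'x set" and op :: "'x \<Rightarrow> 'x \<Rightarrow> 'x" and q :: "'x \<Rightarrow> 'x \<Rightarrow> 'k::field"
    and M :: "(('x list \<Rightarrow> 'k) set, 'm) graded"
begin

abbreviation "T \<equiv> tensor_algebra X :: ('k, 'x list \<Rightarrow> 'k) module"
abbreviation "J \<equiv> nichols_ideal X op q"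
abbreviation "A \<equiv> nichols_algebra X op q"

definition cls :: "('x list \<Rightarrow> 'k) \<Rightarrow> ('x list \<Rightarrow> 'k) set" where
  "cls f = J +>\<^bsub>T\<^esub> f"

definition gen :: "'x \<Rightarrow> 'm \<Rightarrow> 'm" where
  "gen g x = cls (word [g]) \<odot>\<^bsub>M\<^esub> x"

definition scal :: "'k \<Rightarrow> 'm \<Rightarrow> 'm" where
  "scal c x = scalar_mult A M c x"

sublocale ideal: abelian_subgroup J T
  by (rule abelian_subgroup_nichols_ideal)

lemma nichols_algebra_simps:
  "carrier A = a_rcosets\<^bsub>T\<^esub> J"
  "\<one>\<^bsub>A\<^esub> = cls (word [])"
  "\<zero>\<^bsub>A\<^esub> = J"
  "B \<oplus>\<^bsub>A\<^esub> C = B <+>\<^bsub>T\<^esub> C"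
  "B \<otimes>\<^bsub>A\<^esub> C = (\<Union>f\<in>B. \<Union>g\<in>C. cls (f \<otimes>\<^bsub>T\<^esub> g))"
  "c \<odot>\<^bsub>A\<^esub> B = (\<Union>f\<in>B. cls (c \<odot>\<^bsub>T\<^esub> f))"
  "grade A n = cls ` tensor_power X n"
  unfolding nichols_algebra_def Let_def FactRing_def cls_def rcoset_mult_def
  by (simp_all add: tensor_algebra_def)

lemma cls_self: "f \<in> carrier T \<Longrightarrow> f \<in> cls f"
  unfolding cls_def by (rule ideal.a_rcos_self)

lemma cls_closed: "f \<in> carrier T \<Longrightarrow> cls f \<in> carrier A"
  unfolding cls_def nichols_algebra_simps(1) by (rule ideal.a_rcosetsI[OF ideal.a_subset])

text \<open>Products and scalar multiples in the quotient are unions over representatives; with this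
  lemma one element is enough to identify such a coset.\<close>

lemma eq_cls:
  assumes "B \<in> carrier A" "f \<in> B"
  shows "B = cls f"
proof -
  obtain g where "g \<in> carrier T" "B = J +>\<^bsub>T\<^esub> g"
    using assms(1) unfolding nichols_algebra_simps A_RCOSETS_def' by auto
  then show ?thesis
    unfolding cls_def
    using ideal.a_repr_independence[OF _ _ ideal.a_subgroup] assms(2) by simp
qed

text \<open>The ring axioms for the Nichols algebra are part of the hypothesis that \<open>M\<close> is a module over
  it. They say that the product of two cosets is a coset, which is why it is not necessary to know
  that \<open>J\<close> is a two-sided ideal.\<close>

lemma cls_mult:
  assumes "f \<in> carrier T" "g \<in> carrier T" "f \<otimes>\<^bsub>T\<^esub> g \<in> carrier T"
  shows "cls f \<otimes>\<^bsub>A\<^esub> cls g = cls (f \<otimes>\<^bsub>T\<^esub> g)"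
proof (rule eq_cls)
  show "cls f \<otimes>\<^bsub>A\<^esub> cls g \<in> carrier A"
    by (intro R.m_closed cls_closed assms)
  show "f \<otimes>\<^bsub>T\<^esub> g \<in> cls f \<otimes>\<^bsub>A\<^esub> cls g"
    unfolding nichols_algebra_simps using cls_self[OF assms(1)] cls_self[OF assms(2)] cls_self[OF assms(3)]
    by (intro UN_I)
qed

lemma cls_add:
  "f \<in> carrier T \<Longrightarrow> g \<in> carrier T \<Longrightarrow> cls f \<oplus>\<^bsub>A\<^esub> cls g = cls (\<lambda>w. f w + g w)"
  unfolding nichols_algebra_simps cls_def
  by (subst ideal.a_rcos_sum) (simp_all add: tensor_algebra_def)

text \<open>All representatives of the unit contribute the same coset to the union, because
  \<open>J\<close> is closed under scalars.\<close>

lemma scalar_unit: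
  "c \<odot>\<^bsub>A\<^esub> \<one>\<^bsub>A\<^esub> = cls (\<lambda>w. c * word [] w)"
proof -
  have one: "word [] \<in> carrier T" by (simp add: word_closed)
  have "cls (c \<odot>\<^bsub>T\<^esub> f) = cls (\<lambda>w. c * word [] w)" if f: "f \<in> cls (word [])" for f
  proof -
    obtain h where h: "h \<in> J" "f = h \<oplus>\<^bsub>T\<^esub> word []"
      using f unfolding cls_def a_r_coset_def' by blast
    have "c \<odot>\<^bsub>T\<^esub> f = (\<lambda>w. c * h w) \<oplus>\<^bsub>T\<^esub> (\<lambda>w. c * word [] w)"
      unfolding h(2) by (simp add: tensor_algebra_def distrib_left)
    then have "c \<odot>\<^bsub>T\<^esub> f \<in> cls (\<lambda>w. c * word [] w)"
      unfolding cls_def a_r_coset_def' using nichols_ideal_smult[OF h(1)] by blast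
    with cls_closed[OF tensor_smult_closed[OF one]] show ?thesis
      by (rule eq_cls[symmetric])
  qed
  then have "(\<Union>f\<in>cls (word []). cls (c \<odot>\<^bsub>T\<^esub> f)) = (\<Union>f\<in>cls (word []). cls (\<lambda>w. c * word [] w))"
    by (rule SUP_cong[OF refl])
  also have "\<dots> = cls (\<lambda>w. c * word [] w)"
    using cls_self[OF one] by auto
  finally show ?thesis
    unfolding nichols_algebra_simps .
qed

lemma scal_eq: "scal c x = cls (\<lambda>w. c * word [] w) \<odot>\<^bsub>M\<^esub> x"
  unfolding scal_def scalar_mult_def scalar_unit ..

lemma scalar_closed: "(\<lambda>w. c * word [] w) \<in> carrier T"
  by (intro tensor_smult_closed word_closed) simp

lemma tensor_mult_scalar_left: "(\<lambda>w. c * word [] w) \<otimes>\<^bsub>T\<^esub> f = (\<lambda>w. c * f w)"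
proof
  fix w
  have "(\<Sum>i\<le>length w. c * word [] (take i w) * f (drop i w))
      = (\<Sum>i\<in>{0}. c * word [] (take i w) * f (drop i w))"
    by (rule sum.mono_neutral_right) (auto simp: word_def)
  then show "((\<lambda>w. c * word [] w) \<otimes>\<^bsub>T\<^esub> f) w = c * f w"
    by (simp add: tensor_algebra_def word_def)
qed

lemma tensor_mult_scalar_right: "f \<otimes>\<^bsub>T\<^esub> (\<lambda>w. c * word [] w) = (\<lambda>w. c * f w)"
proof
  fix w
  have "(\<Sum>i\<le>length w. f (take i w) * (c * word [] (drop i w)))
      = (\<Sum>i\<in>{length w}. f (take i w) * (c * word [] (drop i w)))"
    by (rule sum.mono_neutral_right) (auto simp: word_def)
  then show "(f \<otimes>\<^bsub>T\<^esub> (\<lambda>w. c * word [] w)) w = c * f w"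
    by (simp add: tensor_algebra_def word_def)
qed

lemma tensor_mult_word: "word u \<otimes>\<^bsub>T\<^esub> word v = word (u @ v)"
proof
  fix w
  show "(word u \<otimes>\<^bsub>T\<^esub> word v) w = (word (u @ v) w :: 'k)"
  proof (cases "w = u @ v")
    case True
    \<comment> \<open>Among the splittings of \<open>w\<close>, only the one at position
      \<open>length u\<close> has prefix \<open>u\<close>.\<close>
    have "(\<Sum>i\<le>length w. word u (take i w) * word v (drop i w))
        = (\<Sum>i\<in>{length u}. word u (take i w) * (word v (drop i w) :: 'k))"
    proof (rule sum.mono_neutral_right)
      have "take i w \<noteq> u" if "i \<le> length w" "i \<noteq> length u" for i
        using that by (metis length_take min.absorb2)
      then show "\<forall>i\<in>{..length w} - {length u}. word u (take i w) * word v (drop i w) = (0 :: 'k)"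
        by (simp add: word_def)
    qed (simp_all add: True)
    then show ?thesis
      using True by (simp add: tensor_algebra_def word_def)
  next
    case False
    then have "word u (take i w) * word v (drop i w) = (0 :: 'k)" for i
      using append_take_drop_id[of i w] by (auto simp: word_def)
    moreover have "word (u @ v) w = (0 :: 'k)"
      using False by (simp add: word_def)
    ultimately show ?thesis
      by (simp add: tensor_algebra_def del: mult_eq_0_iff)
  qed
qed

lemma scal_closed: "x \<in> carrier M \<Longrightarrow> scal c x \<in> carrier M"
  unfolding scal_eq by (intro smult_closed cls_closed scalar_closed)

lemma gen_closed: "g \<in> X \<Longrightarrow> x \<in> carrier M \<Longrightarrow> gen g x \<in> carrier M"
  unfolding gen_def by (intro smult_closed cls_closed word_closed) simp_all

lemma scal_cls:
  assumes "f \<in> carrier T" "x \<in> carrier M"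
  shows "scal c (cls f \<odot>\<^bsub>M\<^esub> x) = cls (\<lambda>w. c * f w) \<odot>\<^bsub>M\<^esub> x"
  unfolding scal_eq
  by (subst smult_assoc[symmetric])
    (simp_all add: assms cls_closed scalar_closed cls_mult tensor_mult_scalar_left tensor_smult_closed)

lemma cls_scal:
  assumes "f \<in> carrier T" "x \<in> carrier M"
  shows "cls f \<odot>\<^bsub>M\<^esub> scal c x = cls (\<lambda>w. c * f w) \<odot>\<^bsub>M\<^esub> x"
  unfolding scal_eq
  by (subst smult_assoc[symmetric])
    (simp_all add: assms cls_closed scalar_closed cls_mult tensor_mult_scalar_right tensor_smult_closed)

text \<open>Multiples of the empty word are central in the tensor algebra, so both sides are the
  action of the class of \<open>c\<close> times the word \<open>[g]\<close>.\<close>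

lemma gen_scal:
  "g \<in> X \<Longrightarrow> x \<in> carrier M \<Longrightarrow> gen g (scal c x) = scal c (gen g x)"
  unfolding gen_def by (simp add: scal_cls cls_scal word_closed)

lemma scal_scal: "x \<in> carrier M \<Longrightarrow> scal c (scal d x) = scal (c * d) x"
  unfolding scal_eq[of d] scal_eq[of "c * d"]
  by (simp add: scal_cls scalar_closed mult.assoc)

lemma cls_add_smult:
  "f \<in> carrier T \<Longrightarrow> g \<in> carrier T \<Longrightarrow> x \<in> carrier M \<Longrightarrow>
    cls (\<lambda>w. f w + g w) \<odot>\<^bsub>M\<^esub> x = cls f \<odot>\<^bsub>M\<^esub> x \<oplus>\<^bsub>M\<^esub> cls g \<odot>\<^bsub>M\<^esub> x"
  by (simp add: cls_add[symmetric] smult_l_distr cls_closed)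

lemma scal_add_left:
  "x \<in> carrier M \<Longrightarrow> scal (c + d) x = scal c x \<oplus>\<^bsub>M\<^esub> scal d x"
  unfolding scal_eq by (simp add: cls_add_smult[symmetric] scalar_closed distrib_right)

lemma ideal_smult:
  assumes "f \<in> J" "x \<in> carrier M"
  shows "cls f \<odot>\<^bsub>M\<^esub> x = \<zero>\<^bsub>M\<^esub>"
proof -
  have "cls f = \<zero>\<^bsub>A\<^esub>"
    unfolding cls_def nichols_algebra_simps by (rule ideal.a_rcos_const[OF assms(1)])
  then show ?thesis using smult_zero_left[OF assms(2)] by simp
qed

lemma scal_zero_left: "x \<in> carrier M \<Longrightarrow> scal 0 x = \<zero>\<^bsub>M\<^esub>"
  unfolding scal_eq using ideal_smult[OF nichols_ideal_zero] by simp

lemma scal_one: "x \<in> carrier M \<Longrightarrow> scal 1 x = x"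
  unfolding scal_eq using smult_one nichols_algebra_simps(2) by simp

lemma scal_zero_right: "scal c \<zero>\<^bsub>M\<^esub> = \<zero>\<^bsub>M\<^esub>"
  unfolding scal_eq by (intro smult_zero_right cls_closed scalar_closed)

lemma gen_add:
  "g \<in> X \<Longrightarrow> x \<in> carrier M \<Longrightarrow> y \<in> carrier M \<Longrightarrow> gen g (x \<oplus>\<^bsub>M\<^esub> y) = gen g x \<oplus>\<^bsub>M\<^esub> gen g y"
  unfolding gen_def by (intro smult_r_distr cls_closed word_closed) simp_all

lemma scal_add_right:
  "x \<in> carrier M \<Longrightarrow> y \<in> carrier M \<Longrightarrow> scal c (x \<oplus>\<^bsub>M\<^esub> y) = scal c x \<oplus>\<^bsub>M\<^esub> scal c y"
  unfolding scal_eq by (intro smult_r_distr cls_closed scalar_closed)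

lemma word_Cons_smult:
  assumes "g \<in> X" "u \<in> lists X" "x \<in> carrier M"
  shows "cls (word (g # u)) \<odot>\<^bsub>M\<^esub> x = gen g (cls (word u) \<odot>\<^bsub>M\<^esub> x)"
  unfolding gen_def
  by (subst smult_assoc[symmetric])
    (use assms in \<open>simp_all add: cls_closed word_closed cls_mult tensor_mult_word\<close>)

lemma word_Nil_smult: "x \<in> carrier M \<Longrightarrow> cls (word []) \<odot>\<^bsub>M\<^esub> x = x"
  using scal_one scal_eq[of 1] by simp

text \<open>Every element of the algebra is the class of a linear combination of words, and a word
  acts by its letters in succession.\<close>

lemma submoduleI:
  assumes N: "subgroup N (add_monoid M)"
    and scal: "\<And>c x. x \<in> N \<Longrightarrow> scal c x \<in> N"
    and gen: "\<And>g x. g \<in> X \<Longrightarrow> x \<in> N \<Longrightarrow> gen g x \<in> N"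
  shows "submodule N A M"
proof (intro submodule.intro submodule_axioms.intro N)
  fix B x assume B: "B \<in> carrier A" and x: "x \<in> N"
  interpret N: subgroup N "add_monoid M" by (rule N)
  have NM: "y \<in> carrier M" if "y \<in> N" for y
    using N.mem_carrier[OF that] by simp
  have word: "cls (word u) \<odot>\<^bsub>M\<^esub> x \<in> N" if "u \<in> lists X" for u
    using that by (induction u) (simp_all add: word_Nil_smult word_Cons_smult NM x gen)
  obtain f where f: "f \<in> carrier T" "B = cls f"
    using B unfolding nichols_algebra_simps A_RCOSETS_def' cls_def by blast
  from f(1) have "cls f \<odot>\<^bsub>M\<^esub> x \<in> N"
  proof (induction rule: tensor_induct)
    case zero
    show ?case
      using ideal_smult[OF nichols_ideal_zero NM[OF x]] N.one_closed by simp
  next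
    case (add c w f)
    have "cls (\<lambda>v. c * word w v + f v) \<odot>\<^bsub>M\<^esub> x
        = scal c (cls (word w) \<odot>\<^bsub>M\<^esub> x) \<oplus>\<^bsub>M\<^esub> cls f \<odot>\<^bsub>M\<^esub> x"
      using add NM[OF x] by (simp add: cls_add_smult scal_cls word_closed tensor_smult_closed)
    then show ?case
      using N.m_closed[OF scal[OF word[OF add(1)], of c] add(3)] by simp
  qed
  then show "B \<odot>\<^bsub>M\<^esub> x \<in> N" using f by simp
qed

lemma scal_grade: "x \<in> grade M i \<Longrightarrow> scal c x \<in> grade M i"
proof -
  assume x: "x \<in> grade M i"
  have "cls (\<lambda>w. c * word [] w) \<in> grade A 0"
    unfolding nichols_algebra_simps tensor_power_def
    using scalar_closed[of c] by (intro imageI) (auto simp: hom_part_def word_def fun_eq_iff)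
  from grade_smult[OF this x] show ?thesis by (simp add: scal_eq)
qed

lemma gen_grade: "g \<in> X \<Longrightarrow> x \<in> grade M i \<Longrightarrow> gen g x \<in> grade M (Suc i)"
proof -
  assume g: "g \<in> X" and x: "x \<in> grade M i"
  have "cls (word [g]) \<in> grade A 1"
    unfolding nichols_algebra_simps tensor_power_def
    using word_closed[of "[g]" X] g by (intro imageI) (auto simp: hom_part_def word_def fun_eq_iff)
  from grade_smult[OF this x] show ?thesis by (simp add: gen_def)
qed

text \<open>The last letter of a word acts first. This turns a quadratic relation of the algebra
  into an equation between scalars.\<close>

lemma word_pair_sum_smult:
  assumes S: "finite S" "S \<subseteq> X" "\<And>h. h \<in> S \<Longrightarrow> \<sigma> h \<in> X"
    and x: "x \<in> carrier M" and z: "z \<in> carrier M"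
    and gen: "\<And>h. h \<in> S \<Longrightarrow> gen (\<sigma> h) (gen h x) = scal (d h) z"
  shows "cls (\<lambda>w. \<Sum>h\<in>S. word [\<sigma> h, h] w) \<odot>\<^bsub>M\<^esub> x = scal (\<Sum>h\<in>S. d h) z"
  using S gen
proof (induction S)
  case empty
  show ?case using ideal_smult[OF nichols_ideal_zero x] scal_zero_left[OF z] by simp
next
  case (insert h S)
  have "cls (word [\<sigma> h, h]) \<odot>\<^bsub>M\<^esub> x = scal (d h) z"
    using insert.prems x by (simp add: word_Cons_smult word_Nil_smult)
  moreover have "(\<lambda>w. \<Sum>h\<in>S. word [\<sigma> h, h] w) \<in> carrier T"
    by (intro tensor_sum_closed insert.hyps word_closed) (use insert.prems in auto)
  ultimately show ?case
    using insert x z by (simp add: cls_add_smult word_closed scal_add_left)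
qed

lemma grade_basis:
  assumes "has_dimension A M (grade M i) 1"
  obtains m where "m \<in> grade M i" "\<And>x. x \<in> grade M i \<Longrightarrow> \<exists>c. x = scal c m"
    "\<And>c. scal c m = \<zero>\<^bsub>M\<^esub> \<Longrightarrow> c = 0"
proof -
  obtain b :: "nat \<Rightarrow> 'm" where b: "b ` {..<1} \<subseteq> grade M i"
    and ex1: "\<forall>x\<in>grade M i. \<exists>!c. c \<in> {..<1} \<rightarrow>\<^sub>E UNIV \<and>
        x = finsum M (\<lambda>i. scalar_mult A M (c i) (b i)) {..<1}"
    using assms unfolding has_dimension_def by blast
  have b0: "b 0 \<in> grade M i" using b by auto
  have fs: "finsum M (\<lambda>i. scalar_mult A M (c i) (b i)) {..<1} = scal (c 0) (b 0)" for c
  proof -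
    have "{..<1} = {0::nat}" by auto
    then show ?thesis
      using scal_closed[OF grade_closed[OF b0]] by (simp add: scal_def)
  qed
  show thesis
  proof (rule that[OF b0])
    fix x assume "x \<in> grade M i"
    then show "\<exists>c. x = scal c (b 0)" using ex1 unfolding fs by blast
  next
    fix c assume c: "scal c (b 0) = \<zero>\<^bsub>M\<^esub>"
    \<comment> \<open>\<open>?e c\<close> is the coordinate function on the index set {0} with value
      \<open>c\<close>, undefined elsewhere. Both \<open>?e c\<close> and \<open>?e 0\<close> are
      coordinates of zero, so they agree.\<close>
    let ?e = "\<lambda>c. \<lambda>i\<in>{..<1::nat}. c"
    have "?e d \<in> {..<1} \<rightarrow>\<^sub>E UNIV" "?e d 0 = d" for d :: 'k by auto
    moreover have "scal 0 (b 0) = \<zero>\<^bsub>M\<^esub>"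
      by (rule scal_zero_left[OF grade_closed[OF b0]])
    ultimately have "?e c = ?e 0"
      using ex1[unfolded fs, rule_format, OF grade_zero] c by metis
    then show "c = 0" by (metis lessThan_iff less_one restrict_apply)
  qed
qed

section \<open>Consequences of generation in degree 0\<close>

lemma subgroup_grade: "subgroup (grade M i) (add_monoid M)"
  using additive_subgroup.a_subgroup[OF grade_subgroup] .

lemma grade_add: "x \<in> grade M i \<Longrightarrow> y \<in> grade M i \<Longrightarrow> x \<oplus>\<^bsub>M\<^esub> y \<in> grade M i"
  using subgroup.m_closed[OF subgroup_grade] by simp

lemma grade_minus: "x \<in> grade M i \<Longrightarrow> \<ominus>\<^bsub>M\<^esub> x \<in> grade M i"
  using subgroup.m_inv_closed[OF subgroup_grade] by (simp add: a_inv_def)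

text \<open>A candidate for a proper submodule containing degree 0, used to show that the generators
  cannot all kill degree 1.\<close>

definition low :: "'m set" where
  "low = {x \<oplus>\<^bsub>M\<^esub> y | x y. x \<in> grade M 0 \<and> y \<in> grade M 1}"

lemma lowI: "z = x \<oplus>\<^bsub>M\<^esub> y \<Longrightarrow> x \<in> grade M 0 \<Longrightarrow> y \<in> grade M 1 \<Longrightarrow> z \<in> low"
  unfolding low_def by blast

lemma lowE:
  assumes "z \<in> low"
  obtains x y where "z = x \<oplus>\<^bsub>M\<^esub> y" "x \<in> grade M 0" "y \<in> grade M 1"
  using assms unfolding low_def by blast

lemma subgroup_low: "subgroup low (add_monoid M)"
proof (rule M.add.subgroupI)
  show "low \<subseteq> carrier M"
    by (auto elim!: lowE intro: grade_closed)
  show "low \<noteq> {}"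
    using lowI[OF refl grade_zero grade_zero] by blast
next
  fix z assume "z \<in> low"
  then obtain x y where "z = x \<oplus>\<^bsub>M\<^esub> y" "x \<in> grade M 0" "y \<in> grade M 1" by (rule lowE)
  then show "\<ominus>\<^bsub>M\<^esub> z \<in> low"
    by (intro lowI[of _ "\<ominus>\<^bsub>M\<^esub> x" "\<ominus>\<^bsub>M\<^esub> y"] grade_minus) (simp_all add: M.minus_add grade_closed)
next
  fix z z' assume "z \<in> low" "z' \<in> low"
  then obtain x y x' y' where "z = x \<oplus>\<^bsub>M\<^esub> y" "x \<in> grade M 0" "y \<in> grade M 1"
    "z' = x' \<oplus>\<^bsub>M\<^esub> y'" "x' \<in> grade M 0" "y' \<in> grade M 1" by (metis lowE)
  then show "z \<oplus>\<^bsub>M\<^esub> z' \<in> low"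
    by (intro lowI[of _ "x \<oplus>\<^bsub>M\<^esub> x'" "y \<oplus>\<^bsub>M\<^esub> y'"] grade_add) (simp_all add: M.a_ac grade_closed)
qed

text \<open>Otherwise degree 0 would be a submodule and hence everything, which contradicts the
  nonzero element of degree 1.\<close>

lemma generator_moves_grade_0:
  assumes gen0: "generated_in_degree_0 A M" and "m \<in> grade M 1" "m \<noteq> \<zero>\<^bsub>M\<^esub>"
  shows "\<exists>g\<in>X. \<exists>x\<in>grade M 0. gen g x \<noteq> \<zero>\<^bsub>M\<^esub>"
proof (rule ccontr)
  assume "\<not> ?thesis"
  then have "submodule (grade M 0) A M"
    by (intro submoduleI subgroup_grade scal_grade) (auto simp: grade_zero)
  then have "grade M 0 = carrier M"
    using gen0 unfolding generated_in_degree_0_def by blast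
  then have "\<ominus>\<^bsub>M\<^esub> m \<in> grade M 0"
    using grade_closed[OF assms(2)] by simp
  \<comment> \<open>Here minus \<open>m\<close> is read in degree 0 and \<open>m\<close> in degree
    1, so independence of degrees forces \<open>m\<close> to be zero.\<close>
  moreover have "\<ominus>\<^bsub>M\<^esub> m \<oplus>\<^bsub>M\<^esub> (m \<oplus>\<^bsub>M\<^esub> \<zero>\<^bsub>M\<^esub>) = \<zero>\<^bsub>M\<^esub>"
    using grade_closed[OF assms(2)] by (simp add: M.l_neg)
  ultimately show False
    using grade_independent(2) assms(2,3) grade_zero by blast
qed

text \<open>If the generators kill degree 1, they map \<open>low\<close> into degree 1, so
  \<open>low\<close> is a submodule containing degree 0. It would then contain the nonzero element
  of degree 2.\<close>

lemma generator_moves_grade_1: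
  assumes gen0: "generated_in_degree_0 A M" and "m \<in> grade M 2" "m \<noteq> \<zero>\<^bsub>M\<^esub>"
  shows "\<exists>g\<in>X. \<exists>x\<in>grade M 1. gen g x \<noteq> \<zero>\<^bsub>M\<^esub>"
proof (rule ccontr)
  assume "\<not> ?thesis"
  then have kill: "gen g x = \<zero>\<^bsub>M\<^esub>" if "g \<in> X" "x \<in> grade M 1" for g x
    using that by blast
  have "submodule low A M"
  proof (intro submoduleI subgroup_low)
    fix c z assume "z \<in> low"
    then obtain x y where "z = x \<oplus>\<^bsub>M\<^esub> y" "x \<in> grade M 0" "y \<in> grade M 1" by (rule lowE)
    then show "scal c z \<in> low"
      by (intro lowI[of _ "scal c x" "scal c y"] scal_grade) (simp_all add: scal_add_right grade_closed)
  next
    fix g z assume g: "g \<in> X" and "z \<in> low"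
    then obtain x y where xy: "z = x \<oplus>\<^bsub>M\<^esub> y" "x \<in> grade M 0" "y \<in> grade M 1" by (metis lowE)
    then have "gen g z = \<zero>\<^bsub>M\<^esub> \<oplus>\<^bsub>M\<^esub> gen g x"
      using g by (simp add: gen_add grade_closed kill gen_closed)
    then show "gen g z \<in> low"
      using gen_grade[OF g xy(2)] by (intro lowI[of _ "\<zero>\<^bsub>M\<^esub>" "gen g x"] grade_zero) simp_all
  qed
  moreover have "grade M 0 \<subseteq> low"
  proof
    fix x assume "x \<in> grade M 0"
    then show "x \<in> low"
      by (intro lowI[of _ x "\<zero>\<^bsub>M\<^esub>"] grade_zero) (simp_all add: grade_closed)
  qed
  ultimately have "low = carrier M"
    using gen0 unfolding generated_in_degree_0_def by blast
  then have "m \<in> low"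
    using grade_closed[OF assms(2)] by simp
  then obtain x y where xy: "m = x \<oplus>\<^bsub>M\<^esub> y" "x \<in> grade M 0" "y \<in> grade M 1" by (rule lowE)
  have "x \<oplus>\<^bsub>M\<^esub> (y \<oplus>\<^bsub>M\<^esub> \<ominus>\<^bsub>M\<^esub> m) = (x \<oplus>\<^bsub>M\<^esub> y) \<oplus>\<^bsub>M\<^esub> \<ominus>\<^bsub>M\<^esub> m"
    using xy(2,3) assms(2) by (intro M.a_assoc[symmetric] M.a_inv_closed) (auto intro: grade_closed)
  also have "\<dots> = \<zero>\<^bsub>M\<^esub>"
    unfolding xy(1)[symmetric] using grade_closed[OF assms(2)] by (simp add: M.r_neg)
  finally have "\<ominus>\<^bsub>M\<^esub> m = \<zero>\<^bsub>M\<^esub>"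
    using grade_independent(3)[OF xy(2,3) grade_minus[OF assms(2)]] by blast
  then show False
    using assms(3) grade_closed[OF assms(2)] M.minus_minus[of m] M.add.inv_one by simp
qed

end

section \<open>Affine racks and the exclusion of truncated point modules\<close>

lemma aff_op_eq:
  assumes "prime p"
  shows "aff_op p \<alpha> g h = ((1 - \<alpha>) * g + \<alpha> * h) mod int p"
proof -
  interpret residues "int p" "residue_ring (int p)"
    using prime_gt_1_nat[OF assms] by unfold_locales simp
  show ?thesis
    unfolding aff_op_def Let_def a_minus_def res_neg_eq
    by (simp add: residue_ring_def mod_simps)
qed

theorem no_truncated_point_module:
  fixes M :: "((int list \<Rightarrow> 'k::field_char_0) set, 'm) graded"
  assumes p: "prime p" and \<alpha>: "coprime \<alpha> (int p)"
  shows "\<not> truncated_point_module 2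
    (nichols_algebra (aff_rack p) (aff_op p \<alpha>) (\<lambda>_ _. - 1)) M"
proof
  assume tpm: "truncated_point_module 2 (nichols_algebra (aff_rack p) (aff_op p \<alpha>) (\<lambda>_ _. - 1)) M"
  interpret nichols_module "aff_rack p" "aff_op p \<alpha>" "\<lambda>_ _. - 1 :: 'k" M
    using tpm by (simp add: truncated_point_module_def nichols_module_def)
  let ?F = "{0..<int p}"
  have X: "aff_rack p = ?F"
    by (auto simp: aff_rack_def residue_ring_def)
  have XI: "g \<in> aff_rack p" if "g \<in> ?F" for g
    using that unfolding X .
  have p0: "int p > 0" using p by (simp add: prime_gt_0_nat)
  have "has_dimension A M (grade M i) 1" if "i \<le> 2" for i
  proof -
    have "fps_nth (\<Sum>j\<le>2. fps_X ^ j :: nat fps) i = 1"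
      using that by (simp add: fps_sum_nth fps_X_power_nth)
    then show ?thesis
      using tpm unfolding truncated_point_module_def has_hilbert_series_def by metis
  qed
  then have dim: "has_dimension A M (grade M 0) 1" "has_dimension A M (grade M 1) 1"
    "has_dimension A M (grade M 2) 1" by simp_all
  obtain m0 where m0: "m0 \<in> grade M 0" "\<And>x. x \<in> grade M 0 \<Longrightarrow> \<exists>c. x = scal c m0"
    using grade_basis[OF dim(1)] by blast
  obtain m1 where m1: "m1 \<in> grade M 1" "\<And>x. x \<in> grade M 1 \<Longrightarrow> \<exists>c. x = scal c m1"
    "\<And>c. scal c m1 = \<zero>\<^bsub>M\<^esub> \<Longrightarrow> c = 0"
    using grade_basis[OF dim(2)] by blast
  obtain m2 where m2: "m2 \<in> grade M 2" "\<And>x. x \<in> grade M 2 \<Longrightarrow> \<exists>c. x = scal c m2"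
    "\<And>c. scal c m2 = \<zero>\<^bsub>M\<^esub> \<Longrightarrow> c = 0"
    using grade_basis[OF dim(3)] by blast
  have m: "m0 \<in> carrier M" "m1 \<in> carrier M" "m2 \<in> carrier M"
    using m0(1) m1(1) m2(1) grade_closed by blast+
  have nonzero: "m1 \<noteq> \<zero>\<^bsub>M\<^esub>" "m2 \<noteq> \<zero>\<^bsub>M\<^esub>"
    using m1(3)[of 1] m2(3)[of 1] scal_zero_right by auto
  have "\<forall>g\<in>?F. \<exists>c. gen g m0 = scal c m1"
    using gen_grade[OF XI m0(1)] m1(2) by simp
  then obtain a where a: "\<And>g. g \<in> ?F \<Longrightarrow> gen g m0 = scal (a g) m1" by metis
  have "\<forall>g\<in>?F. \<exists>c. gen g m1 = scal c m2"
    using gen_grade[OF XI m1(1)] m2(2) by (simp add: numeral_2_eq_2)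
  then obtain b where b: "\<And>g. g \<in> ?F \<Longrightarrow> gen g m1 = scal (b g) m2" by metis
  have gen_gen: "gen g (gen h m0) = scal (a h * b g) m2" if "g \<in> ?F" "h \<in> ?F" for g h
    using m by (simp only: that a b gen_scal XI scal_scal)
  \<comment> \<open>The quadratic element attached to \<open>\<sigma>\<close> acts on
    \<open>m0\<close> as zero and also as this sum times \<open>m2\<close>; since \<open>m2\<close>
    is a basis vector, the sum vanishes.\<close>
  have relation: "(\<Sum>h\<in>S. a h * b (\<sigma> h)) = 0"
    if S: "S \<subseteq> ?F" and \<sigma>: "bij_betw \<sigma> S S"
      and op: "\<And>h. h \<in> S \<Longrightarrow> aff_op p \<alpha> (\<sigma> h) h = \<sigma> (\<sigma> h)" for S \<sigma>
  proof -
    have fin: "finite S" using S finite_subset by blast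
    have \<sigma>F: "\<sigma> h \<in> ?F" if "h \<in> S" for h
      using that S \<sigma> by (meson bij_betwE subsetD)
    have "scal (\<Sum>h\<in>S. a h * b (\<sigma> h)) m2 = cls (\<lambda>w. \<Sum>h\<in>S. word [\<sigma> h, h] w) \<odot>\<^bsub>M\<^esub> m0"
    proof (rule word_pair_sum_smult[symmetric])
      show "gen (\<sigma> h) (gen h m0) = scal (a h * b (\<sigma> h)) m2" if "h \<in> S" for h
        using that S \<sigma>F by (intro gen_gen) auto
    qed (use fin S \<sigma>F m XI in blast)+
    also have "\<dots> = \<zero>\<^bsub>M\<^esub>"
      by (intro ideal_smult word_pair_sum_mem_nichols_ideal m fin \<sigma> op) (use S XI in blast)+
    finally show ?thesis by (rule m2(3))
  qed
  have "\<exists>g\<in>?F. a g \<noteq> 0"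
  proof -
    obtain g x where gx: "g \<in> ?F" "x \<in> grade M 0" "gen g x \<noteq> \<zero>\<^bsub>M\<^esub>"
      using generator_moves_grade_0[OF _ m1(1) nonzero(1)] tpm X
      unfolding truncated_point_module_def by blast
    obtain c where "x = scal c m0" using m0(2)[OF gx(2)] by blast
    then have "a g \<noteq> 0"
      using gx(3) m by (auto simp: gen_scal[OF XI[OF gx(1)]] a[OF gx(1)] scal_zero_left scal_zero_right)
    with gx(1) show ?thesis by blast
  qed
  then obtain w where w: "w \<in> ?F" "a w \<noteq> 0" by blast
  have "\<exists>g\<in>?F. b g \<noteq> 0"
  proof -
    obtain g x where gx: "g \<in> ?F" "x \<in> grade M 1" "gen g x \<noteq> \<zero>\<^bsub>M\<^esub>"
      using generator_moves_grade_1[OF _ m2(1) nonzero(2)] tpm X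
      unfolding truncated_point_module_def by blast
    obtain c where "x = scal c m1" using m1(2)[OF gx(2)] by blast
    then have "b g \<noteq> 0"
      using gx(3) m by (auto simp: gen_scal[OF XI[OF gx(1)]] b[OF gx(1)] scal_zero_left scal_zero_right)
    with gx(1) show ?thesis by blast
  qed
  then obtain v where v: "v \<in> ?F" "b v \<noteq> 0" by blast
  show False
  proof (rule no_orthogonal_pair[where a = a and b = b, OF p \<alpha> w v])
    fix g assume g: "g \<in> ?F"
    \<comment> \<open>Idempotence of the rack makes the identity on {g} admissible.\<close>
    then have "aff_op p \<alpha> g g = g"
      by (simp add: aff_op_eq[OF p] algebra_simps)
    then show "a g * b g = 0"
      using relation[of "{g}" "\<lambda>h. h"] g by simp
  next
    fix t assume "t \<in> ?F"
    show "(\<Sum>h\<in>?F. a h * b ((t - \<alpha> * h) mod int p)) = 0"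
    proof (rule relation)
      \<comment> \<open>Multiplication by \<alpha> is injective modulo \<open>p\<close>, and an
        injective self-map of a finite set is bijective.\<close>
      have "inj_on (\<lambda>h. (t - \<alpha> * h) mod int p) ?F"
      proof
        fix x y assume xy: "x \<in> ?F" "y \<in> ?F" "(t - \<alpha> * x) mod int p = (t - \<alpha> * y) mod int p"
        then have "[t - \<alpha> * x = t - \<alpha> * y] (mod int p)" by (simp add: cong_def)
        then have "[\<alpha> * x = \<alpha> * y] (mod int p)"
          using cong_diff[OF cong_refl[of t]] by fastforce
        then have "[x = y] (mod int p)"
          using cong_mult_lcancel[OF \<alpha>] by blast
        then show "x = y" using xy by (simp add: cong_def)
      qed
      moreover have "(\<lambda>h. (t - \<alpha> * h) mod int p) ` ?F \<subseteq> ?F"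
        using p0 by auto
      ultimately show "bij_betw (\<lambda>h. (t - \<alpha> * h) mod int p) ?F ?F"
        by (simp add: bij_betw_def endo_inj_surj)
    next
      fix h
      show "aff_op p \<alpha> ((t - \<alpha> * h) mod int p) h = (t - \<alpha> * ((t - \<alpha> * h) mod int p)) mod int p"
        (is "_ = (t - \<alpha> * ?s) mod int p")
      proof -
        \<comment> \<open>With s = t - \<alpha> h, the rack product of s and h is s + \<alpha> h -
          \<alpha> s = t - \<alpha> s modulo \<open>p\<close>.\<close>
        have "[?s + \<alpha> * h - \<alpha> * ?s = t - \<alpha> * ?s] (mod int p)"
          by (intro cong_diff cong_refl) (simp add: cong_def mod_simps)
        moreover have "(1 - \<alpha>) * ?s + \<alpha> * h = ?s + \<alpha> * h - \<alpha> * ?s"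
          by (simp add: left_diff_distrib)
        ultimately show ?thesis
          unfolding aff_op_eq[OF p] cong_def by (simp only:)
      qed
    qed simp
  qed
qed

theorem theorem1p3:
  fixes p :: nat and \<alpha> :: int
  assumes "prime p"
    and "\<alpha> \<in> Units (residue_ring (int p))"
    and "\<alpha> \<noteq> \<one>\<^bsub>residue_ring (int p)\<^esub>"
  shows "(Gamma 2 (nichols_algebra (aff_rack p) (aff_op p \<alpha>)
            (\<lambda>_ _. - 1 :: 'k :: field_char_0)) :: (_, 'm) graded set set) = {}"
proof -
  interpret residues "int p" "residue_ring (int p)"
    using prime_gt_1_nat[OF assms(1)] by unfold_locales simp
  have "coprime \<alpha> (int p)"
    using assms(2) by (simp add: res_units_eq)
  \<comment> \<open>The quotient of an empty set of modules has no classes.\<close>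
  then show ?thesis
    by (simp add: Gamma_def no_truncated_point_module[OF assms(1)])
qed

end
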